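(* Let $M\ge 1$ and $S=M+1$. The ADER-IWF-RK-GLG method with $S$ stages (built on $S=M+1$ Gauss–Legendre subtimenodes, which are also used as quadrature points) is of order $2S-1$.
   Context: Consider the ODE system $\frac{d}{dt}\boldsymbol{u}=\boldsymbol{G}(t,\boldsymbol{u})$, with $\boldsymbol{u}(t)\in\mathbb{R}^Q$ and $\boldsymbol{G}$ continuous and Lipschitz in $\boldsymbol{u}$ uniformly in $t$. An $S$-stage (implicit) Runge–Kutta (RK) method with coefficients $A=(a_{s,r})$, $\boldsymbol{b}=(b_r)$, $\boldsymbol{c}=(c_r)$, $s,r=0,\dots,S-1$, computes from $\boldsymbol{u}_n\approx \boldsymbol{u}(t_n)$ the approximation $\boldsymbol{u}_{n+1}\approx\boldsymbol{u}(t_n+\Delta t)$ through $$\boldsymbol{y}^s=\boldsymbol{u}_n+\Delta t\sum_{r=0}^{S-1}a_{s,r}\boldsymbol{G}(t_n+c_r\Delta t,\boldsymbol{y}^r),\ s=0,\dots,S-1,\qquad \boldsymbol{u}_{n+1}=\boldsymbol{u}_n+\Delta t\sum_{r=0}^{S-1}b_r\boldsymbol{G}(t_n+c_r\Delta t,\boldsymbol{y}^r).$$ It is of order $p$ if, for sufficiently smooth $\boldsymbol{G}$ and $\boldsymbol{u}_n=\boldsymbol{u}(t_n)$, one has $\boldsymbol{u}_{n+1}-\boldsymbol{u}(t_n+\Delta t)=O(\Delta t^{p+1})$ as $\Delta t\to0$. ADER-IWF-RK-GLG method: let $0<\xi^0<\dots<\xi^M<1$ be the $M+1$ Gauss–Legendre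 (GLG) points on $[0,1]$ (the roots of the degree-$(M+1)$ Legendre polynomial shifted to $[0,1]$), let $\widehat\psi^m$, $m=0,\dots,M$, be the associated Lagrange basis polynomials of degree $M$, and let $w_m=\int_0^1\widehat\psi^m(\xi)\,d\xi$ be the quadrature weights (the quadrature with nodes $\xi^m$ and weights $w_m$ is exact for polynomials of degree at most $2M+1=2S-1$). Define the $(M+1)\times(M+1)$ matrices, with all integrals computed by this quadrature, $$B_{\ell,m}=\widehat\psi^\ell(1)\widehat\psi^m(1)-\sum_{q=0}^M w_q\Big(\tfrac{d}{d\xi}\widehat\psi^\ell\Big)(\xi^q)\,\widehat\psi^m(\xi^q),\qquad \Lambda_{\ell,m}=\sum_{q=0}^M w_q\widehat\psi^\ell(\xi^q)\widehat\psi^m(\xi^q)=w_\ell\delta_{\ell,m}.$$ The method is the RK method with $S=M+1$ stages, $A=B^{-1}\Lambda$, $c_m=\xi^m$, $b_m=w_m$. *)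

theory Defs
  imports
    "HOL-Analysis.Analysis"
    "HOL-Computational_Algebra.Polynomial"
    "HOL-Library.Landau_Symbols"
    "Jordan_Normal_Form.Gauss_Jordan_Elimination"
begin

section \<open>Order of an implicit Runge--Kutta method\<close>

text \<open>
  \<open>Ck k f\<close>: \<open>f\<close> is of class \<open>C^k\<close>. The recursion runs over the directional derivatives
  \<open>\<lambda>x. f' x v\<close> so that the type of \<open>f\<close> does not change; on finite-dimensional spaces this is
  the usual class \<open>C^k\<close>.
\<close>

primrec Ck :: "nat \<Rightarrow> ('a::real_normed_vector \<Rightarrow> 'b::real_normed_vector) \<Rightarrow> bool" where
  "Ck 0 f \<longleftrightarrow> continuous_on UNIV f"
| "Ck (Suc k) f \<longleftrightarrow>
     (\<exists>f'. (\<forall>x. (f has_derivative f' x) (at x)) \<and> (\<forall>v. Ck k (\<lambda>x. f' x v)))"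

definition admissible_rhs :: "(real \<Rightarrow> real ^ 'q::finite \<Rightarrow> real ^ 'q) \<Rightarrow> bool" where
  "admissible_rhs G \<longleftrightarrow>
     continuous_on UNIV (\<lambda>(t, v). G t v) \<and> (\<exists>L. \<forall>t. L-lipschitz_on UNIV (G t))"

definition ode_solution ::
    "(real \<Rightarrow> real ^ 'q::finite \<Rightarrow> real ^ 'q) \<Rightarrow> (real \<Rightarrow> real ^ 'q) \<Rightarrow> bool" where
  "ode_solution G u \<longleftrightarrow> (\<forall>t. (u has_vector_derivative G t (u t)) (at t))"

text \<open>
  One step of size \<open>h\<close> from \<open>(t, un)\<close> is a relation, because the stages \<open>y 0, \<dots>, y (S - 1)\<close> are
  only given implicitly.
\<close>

definition rk_step ::
    "nat \<Rightarrow> real mat \<Rightarrow> (nat \<Rightarrow> real) \<Rightarrow> (nat \<Rightarrow> real) \<Rightarrow>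
     (real \<Rightarrow> real ^ 'q::finite \<Rightarrow> real ^ 'q) \<Rightarrow> real \<Rightarrow> real \<Rightarrow> real ^ 'q \<Rightarrow> real ^ 'q \<Rightarrow> bool" where
  "rk_step S A b c G t h un un1 \<longleftrightarrow>
     (\<exists>y. (\<forall>s<S. y s = un + h *\<^sub>R (\<Sum>r<S. (A $$ (s, r)) *\<^sub>R G (t + c r * h) (y r))) \<and>
          un1 = un + h *\<^sub>R (\<Sum>r<S. b r *\<^sub>R G (t + c r * h) (y r)))"

text \<open>
  ``Sufficiently smooth'' is: of class \<open>C^k\<close> for some \<open>k\<close> that does not depend on \<open>G\<close>. Since steps
  are relational, the order statement includes that for all small \<open>h > 0\<close> the step can be carried
  out, and the error bound is required of every choice \<open>U h\<close> of its result.
\<close>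

definition rk_order ::
    "'q::finite itself \<Rightarrow> nat \<Rightarrow> real mat \<Rightarrow> (nat \<Rightarrow> real) \<Rightarrow> (nat \<Rightarrow> real) \<Rightarrow> nat \<Rightarrow> bool" where
  "rk_order Q S A b c p \<longleftrightarrow>
     (\<exists>k. \<forall>(G :: real \<Rightarrow> real ^ 'q \<Rightarrow> real ^ 'q) u t.
        admissible_rhs G \<longrightarrow> Ck k (\<lambda>(t, v). G t v) \<longrightarrow> ode_solution G u \<longrightarrow>
          (\<forall>\<^sub>F h in at_right 0. \<exists>U. rk_step S A b c G t h (u t) U) \<and>
          (\<forall>U. (\<forall>\<^sub>F h in at_right 0. rk_step S A b c G t h (u t) (U h)) \<longrightarrow>
               (\<lambda>h. norm (U h - u (t + h))) \<in> O[at_right 0](\<lambda>h. h ^ (p + 1))))"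

section \<open>The ADER-IWF-RK-GLG method\<close>

text \<open>Rodrigues' formula.\<close>

definition legendre :: "nat \<Rightarrow> real poly" where
  "legendre n = Polynomial.smult (1 / (2 ^ n * fact n)) ((pderiv ^^ n) ([:-1, 0, 1:] ^ n))"

definition shifted_legendre :: "nat \<Rightarrow> real poly" where
  "shifted_legendre n = pcompose (legendre n) [:-1, 2:]"

text \<open>
  These conditions determine \<open>xi 0, \<dots>, xi M\<close>: a polynomial of degree \<open>M + 1\<close> has at most \<open>M + 1\<close>
  roots.
\<close>

definition glg_points :: "nat \<Rightarrow> (nat \<Rightarrow> real) \<Rightarrow> bool" where
  "glg_points M xi \<longleftrightarrow>
     strict_mono_on {..M} xi \<and> 0 < xi 0 \<and> xi M < 1 \<and>
     (\<forall>m\<le>M. poly (shifted_legendre (M + 1)) (xi m) = 0)"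

definition lagrange :: "nat \<Rightarrow> (nat \<Rightarrow> real) \<Rightarrow> nat \<Rightarrow> real poly" where
  "lagrange M xi m = (\<Prod>j\<in>{..M} - {m}. Polynomial.smult (1 / (xi m - xi j)) [:- xi j, 1:])"

definition quad_weight :: "nat \<Rightarrow> (nat \<Rightarrow> real) \<Rightarrow> nat \<Rightarrow> real" where
  "quad_weight M xi m = integral {0..1} (poly (lagrange M xi m))"

definition ader_B :: "nat \<Rightarrow> (nat \<Rightarrow> real) \<Rightarrow> real mat" where
  "ader_B M xi = mat (M + 1) (M + 1) (\<lambda>(l, m).
     poly (lagrange M xi l) 1 * poly (lagrange M xi m) 1 -
     (\<Sum>q\<le>M. quad_weight M xi q *
        poly (pderiv (lagrange M xi l)) (xi q) * poly (lagrange M xi m) (xi q)))"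

definition ader_Lambda :: "nat \<Rightarrow> (nat \<Rightarrow> real) \<Rightarrow> real mat" where
  "ader_Lambda M xi = mat (M + 1) (M + 1) (\<lambda>(l, m).
     (\<Sum>q\<le>M. quad_weight M xi q *
        poly (lagrange M xi l) (xi q) * poly (lagrange M xi m) (xi q)))"

text \<open>Only meaningful if \<open>ader_B M xi\<close> is invertible (otherwise \<open>mat_inverse\<close> is \<open>None\<close>).\<close>

definition ader_A :: "nat \<Rightarrow> (nat \<Rightarrow> real) \<Rightarrow> real mat" where
  "ader_A M xi = the (mat_inverse (ader_B M xi)) * ader_Lambda M xi"

end

theory Submission
  imports
    Defs
    "HOL-Probability.Discrete_Topology"
    "Jordan_Normal_Form.Determinant"
begin

text \<open>
  Multiplying the stage equations by \<open>B\<close> turns the method into its weak form: with \<open>Q\<close> the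
  Gauss quadrature, every polynomial \<open>p\<close> of degree at most \<open>M\<close> satisfies
  \<open>p(1) U = p(0) u\<^sub>n + Q(p' y) + h Q(p G(y))\<close>. The exact solution satisfies the same identity up
  to a quadrature error \<open>O(h\<^bsup>2M+2\<^esup>)\<close>. Subtracting, and linearizing \<open>G\<close> along the solution with
  Jacobian \<open>J\<close>, the error \<open>e\<close> of the step is tested against a vector-valued \<open>p\<close>:
  \<open>p(1) \<cdot> e = Q((p' + h J\<^sup>T p) \<cdot> \<epsilon>) + O(h\<^bsup>2M+2\<^esup>)\<close>, where the stage errors \<open>\<epsilon>\<close> are
  \<open>O(h\<^bsup>M+1\<^esup>)\<close>. If \<open>p\<close> is the Taylor polynomial of degree \<open>M\<close> of a solution of the adjoint
  equation, its residual \<open>p' + h J\<^sup>T p\<close> is again \<open>O(h\<^bsup>M+1\<^esup>)\<close>, and the two factors together give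
  \<open>O(h\<^bsup>2M+2\<^esup>)\<close>. Letting \<open>p(0)\<close> run through a basis bounds \<open>e\<close>.
\<close>

section \<open>Gauss--Legendre quadrature\<close>

lemma poly_antiderivative:
  obtains P :: "real poly" where "pderiv P = p" "poly P 0 = 0"
proof
  let ?P = "\<Sum>i\<le>Polynomial.degree p. Polynomial.monom (Polynomial.coeff p i / (of_nat i + 1)) (i + 1)"
  have "pderiv ?P = (\<Sum>i\<le>Polynomial.degree p. Polynomial.monom (Polynomial.coeff p i) i)"
    unfolding higher_pderiv_sum[of 1, simplified]
    by (intro sum.cong refl) (simp add: pderiv_monom add.commute add_nonneg_eq_0_iff)
  then show "pderiv ?P = p"
    by (simp add: poly_as_sum_of_monoms)
  show "poly ?P 0 = 0"
    by (simp add: poly_sum poly_monom)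
qed

text \<open>A functional on polynomials rather than on functions: by
  \<open>poly_antiderivative\<close> and \<open>I01_pderiv\<close> every value is an endpoint
  difference, so the algebra of integrals reduces to the algebra of \<open>pderiv\<close>.\<close>

definition I01 :: "real poly \<Rightarrow> real" where
  "I01 p = integral {0..1} (poly p)"

lemma I01_pderiv: "I01 (pderiv P) = poly P 1 - poly P 0"
proof -
  have "(poly (pderiv P) has_integral poly P 1 - poly P 0) {0..1}"
    by (intro fundamental_theorem_of_calculus)
      (auto simp: poly_DERIV has_real_derivative_iff_has_vector_derivative[symmetric]
        intro: has_field_derivative_at_within)
  then show ?thesis
    unfolding I01_def by (rule integral_unique)
qed

lemma poly_integrable_on: "poly (p :: real poly) integrable_on {0..1}"
  by (intro integrable_continuous_interval continuous_on_poly continuous_on_id)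

lemma I01_add: "I01 (p + q) = I01 p + I01 q"
proof -
  obtain P R where "pderiv P = p" "pderiv R = q"
    using poly_antiderivative by metis
  then show ?thesis
    using I01_pderiv[of "P + R"] by (auto simp: pderiv_add I01_pderiv)
qed

lemma I01_smult: "I01 (Polynomial.smult c p) = c * I01 p"
proof -
  obtain P where "pderiv P = p"
    using poly_antiderivative by metis
  then show ?thesis
    using I01_pderiv[of "Polynomial.smult c P"] by (auto simp: pderiv_smult I01_pderiv algebra_simps)
qed

lemma I01_0 [simp]: "I01 0 = 0"
  using I01_smult[of 0 0] by simp

lemma I01_sum: "I01 (sum f A) = (\<Sum>x\<in>A. I01 (f x))"
  by (induction A rule: infinite_finite_induct) (auto simp: I01_add)

lemma I01_by_parts:
  "I01 (p * pderiv q) = poly p 1 * poly q 1 - poly p 0 * poly q 0 - I01 (pderiv p * q)"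
proof -
  have "I01 (p * pderiv q) + I01 (pderiv p * q) = I01 (pderiv (p * q))"
    by (simp add: pderiv_mult I01_add algebra_simps flip: I01_add)
  then show ?thesis
    by (simp add: I01_pderiv)
qed

text \<open>A nonnegative continuous function with zero integral vanishes on the whole interval, and
  only the zero polynomial has infinitely many roots. This supplies the definiteness behind the
  invertibility of \<open>B\<close>.\<close>

lemma I01_square_eq_0:
  assumes "I01 (p * p) = 0"
  shows "p = 0"
proof -
  have "((\<lambda>x. poly (p * p) x) has_integral 0) (cbox 0 1)"
    using assms integrable_integral[OF poly_integrable_on, of "p * p"] by (simp add: I01_def del: poly_mult)
  then have "poly (p * p) x = 0" if "x \<in> {0..1}" for x
    using has_integral_0_cbox_imp_0[of 0 1 "poly (p * p)" x] that
      continuous_on_poly[OF continuous_on_id, of "{0..1}" "p * p"]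
    by (simp del: poly_mult) simp
  then have "{0..1} \<subseteq> {x. poly p x = 0}"
    by auto
  then have "infinite {x. poly p x = 0}"
    by (rule infinite_super) simp
  then show ?thesis
    using poly_roots_finite by blast
qed

section \<open>Orthogonality of the shifted Legendre polynomials\<close>

lemma power_dvd_pderiv:
  fixes p f :: "real poly"
  assumes "p ^ Suc n dvd f"
  shows "p ^ n dvd pderiv f"
proof -
  obtain g where "f = p ^ Suc n * g" using assms by blast
  then have "pderiv f = p ^ n * (Polynomial.smult (of_nat (Suc n)) (pderiv p * g) + p * pderiv g)"
    by (simp only: pderiv_mult pderiv_power_Suc) (simp add: algebra_simps smult_add_right del: of_nat_Suc)
  then show ?thesis by simp
qed

text \<open>Each differentiation costs one power of \<open>p\<close>. For \<open>p\<close> vanishing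
  at 0 and 1, all derivatives of \<open>p ^ n\<close> of order below \<open>n\<close> therefore
  vanish there too.\<close>

lemma power_dvd_higher_pderiv:
  fixes p :: "real poly"
  assumes "j \<le> n"
  shows "p ^ (n - j) dvd (pderiv ^^ j) (p ^ n)"
  using assms
proof (induction j)
  case (Suc j)
  then have "p ^ Suc (n - Suc j) dvd (pderiv ^^ j) (p ^ n)"
    by (simp add: Suc_diff_Suc del: power_Suc)
  from power_dvd_pderiv[OF this] show ?case by simp
qed simp

text \<open>Repeated integration by parts: the boundary terms vanish by assumption, and each step
  moves one derivative onto \<open>q\<close>, which is eventually differentiated to 0 because its
  degree is below \<open>k\<close>.\<close>

lemma I01_higher_pderiv_eq_0:
  assumes "\<And>j. j < k \<Longrightarrow> poly ((pderiv ^^ j) W) 0 = 0 \<and> poly ((pderiv ^^ j) W) 1 = 0"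
    and "Polynomial.degree q < k"
  shows "I01 (q * (pderiv ^^ k) W) = 0"
  using assms
proof (induction k arbitrary: q)
  case (Suc k)
  have *: "I01 (q * (pderiv ^^ Suc k) W) = - I01 (pderiv q * (pderiv ^^ k) W)"
    using Suc.prems(1)[of k] by (simp add: I01_by_parts)
  show ?case
  proof (cases "Polynomial.degree q = 0")
    case True
    then have "pderiv q = 0" by (simp add: pderiv_eq_0_iff)
    then show ?thesis unfolding * by simp
  next
    case False
    then show ?thesis
      unfolding * using Suc.prems by (subst Suc.IH) (auto simp: degree_pderiv)
  qed
qed simp

lemma higher_pderiv_pcompose_linear:
  "(pderiv ^^ n) (pcompose p [:a, b:]) = Polynomial.smult (b ^ n) (pcompose ((pderiv ^^ n) p) [:a, b :: real:])"
  by (induction n) (auto simp: pderiv_smult pderiv_pcompose pderiv_pCons algebra_simps)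

lemma pcompose_power: "pcompose (p ^ n) q = pcompose p q ^ n"
  by (induction n) (auto simp: pcompose_mult pcompose_1)

text \<open>The substitution of 2x - 1 for x turns x^2 - 1 into 4x(x - 1), and the chain rule
  contributes only powers of 2. Neither orthogonality, nor roots, nor the degree depend on the value
  of the nonzero factor \<open>c\<close>.\<close>

lemma shifted_legendre_eq:
  obtains c where "c \<noteq> 0"
    "shifted_legendre n = Polynomial.smult c ((pderiv ^^ n) ([:0, -4, 4:] ^ n))"
proof
  let ?W = "[:-1, 0, 1:] ^ n :: real poly"
  have "pcompose ?W [:-1, 2:] = [:0, -4, 4:] ^ n"
    by (simp add: pcompose_power pcompose_pCons)
  with higher_pderiv_pcompose_linear[of n ?W "-1" 2]
  have "(pderiv ^^ n) ([:0, -4, 4:] ^ n) = Polynomial.smult (2 ^ n) (pcompose ((pderiv ^^ n) ?W) [:-1, 2:])"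
    by simp
  then show "shifted_legendre n = Polynomial.smult (1 / (2 ^ n * 2 ^ n * fact n)) ((pderiv ^^ n) ([:0, -4, 4:] ^ n))"
    by (simp add: shifted_legendre_def legendre_def pcompose_smult field_simps)
qed auto

text \<open>Rodrigues' formula makes the polynomial an \<open>n\<close>-th derivative of a power of
  x(x - 1), whose lower derivatives vanish at both endpoints, so
  \<open>I01_higher_pderiv_eq_0\<close> applies.\<close>

lemma I01_shifted_legendre:
  assumes "Polynomial.degree q < n"
  shows "I01 (q * shifted_legendre n) = 0"
proof -
  obtain c where c: "shifted_legendre n = Polynomial.smult c ((pderiv ^^ n) ([:0, -4, 4:] ^ n))"
    by (rule shifted_legendre_eq)
  have "poly ((pderiv ^^ j) ([:0, -4, 4:] ^ n)) x = 0" if "j < n" "x = 0 \<or> x = 1" for j and x :: real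
  proof -
    have "[:0, -4, 4:] ^ (n - j) dvd (pderiv ^^ j) ([:0, -4, 4:] ^ n :: real poly)"
      using that by (intro power_dvd_higher_pderiv) auto
    then have "poly ([:0, -4, 4:] ^ (n - j)) x dvd poly ((pderiv ^^ j) ([:0, -4, 4:] ^ n)) x"
      by (auto elim!: dvdE)
    then show ?thesis using that by (auto simp: power_0_left)
  qed
  then have "I01 (q * (pderiv ^^ n) ([:0, -4, 4:] ^ n)) = 0"
    using assms by (intro I01_higher_pderiv_eq_0) auto
  then show ?thesis by (simp add: c I01_smult)
qed

lemma degree_shifted_legendre: "Polynomial.degree (shifted_legendre n) = n"
  by (rule shifted_legendre_eq[of n]) (simp add: degree_higher_pderiv degree_power_eq)

section \<open>Interpolation and quadrature at the Gauss points\<close>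

locale glg =
  fixes M :: nat and xi :: "nat \<Rightarrow> real"
  assumes glg: "glg_points M xi"
begin

lemma xi_inj: "inj_on xi {..M}"
  using glg unfolding glg_points_def by (auto intro: strict_mono_on_imp_inj_on)

lemma xi_pos: "m \<le> M \<Longrightarrow> 0 < xi m"
  using glg strict_mono_onD[of "{..M}" xi 0 m] unfolding glg_points_def
  by (cases "m = 0") force+

lemma xi_root: "m \<le> M \<Longrightarrow> poly (shifted_legendre (M + 1)) (xi m) = 0"
  using glg unfolding glg_points_def by auto

abbreviation "psi \<equiv> lagrange M xi"
abbreviation "w \<equiv> quad_weight M xi"

definition Q :: "real poly \<Rightarrow> real" where
  "Q p = (\<Sum>q\<le>M. w q * poly p (xi q))"

lemma poly_psi:
  assumes "l \<le> M" "j \<le> M"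
  shows "poly (psi l) (xi j) = (if j = l then 1 else 0)"
proof (cases "j = l")
  case True
  have "xi l - xi i \<noteq> 0" if "i \<in> {..M} - {l}" for i
    using that inj_onD[OF xi_inj, of l i] assms by auto
  then show ?thesis unfolding lagrange_def poly_prod True by (auto intro!: prod.neutral simp flip: diff_divide_distrib)
next
  case False
  then show ?thesis using assms unfolding lagrange_def poly_prod by (auto intro!: prod_zero)
qed

lemma degree_psi: "l \<le> M \<Longrightarrow> Polynomial.degree (psi l) \<le> M"
proof -
  assume "l \<le> M"
  have "Polynomial.degree (psi l) \<le> (\<Sum>j\<in>{..M} - {l}. 1)"
    unfolding lagrange_def
    by (rule order.trans[OF degree_prod_sum_le]) (auto intro!: sum_mono simp del: sum_constant card_Diff_singleton_if split: if_splits)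
  then show ?thesis using \<open>l \<le> M\<close> by simp
qed

lemma poly_eq_on_nodes:
  assumes "Polynomial.degree p \<le> M" "Polynomial.degree q \<le> M"
    and "\<And>m. m \<le> M \<Longrightarrow> poly p (xi m) = poly q (xi m)"
  shows "p = q"
  using assms by (intro poly_eqI_degree[of "xi ` {..M}"]) (auto simp: card_image[OF xi_inj])

lemma degree_lincomb_psi: "Polynomial.degree (\<Sum>l\<le>M. Polynomial.smult (c l) (psi l)) \<le> M"
  by (intro degree_sum_le) (auto intro: order.trans[OF degree_smult_le] degree_psi)

lemma poly_lincomb_psi:
  "m \<le> M \<Longrightarrow> poly (\<Sum>l\<le>M. Polynomial.smult (c l) (psi l)) (xi m) = c m"
  by (simp add: poly_sum poly_psi if_distrib sum.delta cong: if_cong)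

lemma interpolation:
  assumes "Polynomial.degree p \<le> M"
  shows "p = (\<Sum>l\<le>M. Polynomial.smult (poly p (xi l)) (psi l))"
  using assms by (intro poly_eq_on_nodes) (auto simp: degree_lincomb_psi poly_lincomb_psi)

text \<open>The weights are the integrals of the Lagrange basis, so integrating the interpolant,
  which is \<open>p\<close> itself, gives \<open>Q p\<close>.\<close>

lemma Q_exact_interp:
  assumes "Polynomial.degree p \<le> M"
  shows "I01 p = Q p"
proof -
  have "I01 p = (\<Sum>l\<le>M. poly p (xi l) * I01 (psi l))"
    by (subst interpolation[OF assms]) (simp add: I01_sum I01_smult)
  then show ?thesis
    by (simp add: Q_def quad_weight_def I01_def mult_ac)
qed

text \<open>Gauss' argument: divide \<open>p\<close> by the Legendre polynomial \<open>P\<close> of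
  degree \<open>M + 1\<close>. The quotient has degree at most \<open>M\<close>, so its product with
  \<open>P\<close> has zero integral by orthogonality; the nodes are roots of \<open>P\<close>, so
  \<open>Q\<close> does not see that product either. The remainder has degree at most
  \<open>M\<close> and is handled by interpolation.\<close>

lemma Q_exact:
  assumes "Polynomial.degree p \<le> 2 * M + 1"
  shows "I01 p = Q p"
proof -
  define P where "P = shifted_legendre (M + 1)"
  have dP: "Polynomial.degree P = M + 1" unfolding P_def by (rule degree_shifted_legendre)
  then have P0: "P \<noteq> 0" by auto
  have p: "p = p div P * P + p mod P" by simp
  have d1: "Polynomial.degree (p mod P) \<le> M"
    using degree_mod_less[OF P0, of p] dP by auto
  have d2: "Polynomial.degree (p div P) < M + 1"
  proof (cases "p div P = 0")
    case False
    have "Polynomial.degree (p div P * P) = Polynomial.degree (p - p mod P)"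
      by (simp add: minus_mod_eq_div_mult)
    also have "\<dots> \<le> 2 * M + 1"
      using assms d1 by (intro degree_diff_le) auto
    finally show ?thesis
      using False P0 dP by (simp add: degree_mult_eq)
  qed simp
  have "I01 p = I01 (p mod P)"
    using I01_shifted_legendre[OF d2] by (subst p, subst I01_add) (simp add: P_def)
  also have "\<dots> = Q (p mod P)" by (rule Q_exact_interp[OF d1])
  also have "\<dots> = Q p"
  proof -
    have "poly p (xi q) = poly (p mod P) (xi q)" if "q \<le> M" for q
      by (subst p, subst poly_add) (simp add: P_def xi_root[OF that, simplified])
    then show ?thesis by (auto simp: Q_def)
  qed
  finally show ?thesis .
qed

end

section \<open>The weak form of the method\<close>

text \<open>A trivial kernel gives a nonzero determinant, hence a unit of the matrix ring, and
  \<open>mat_inverse\<close> succeeds. This gives meaning to the \<open>the\<close> in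
  \<open>ader_A\<close>.\<close>

lemma ex_mat_inverse:
  fixes B :: "real mat"
  assumes B: "B \<in> carrier_mat n n" and inj: "\<And>v. v \<in> carrier_vec n \<Longrightarrow> B *\<^sub>v v = 0\<^sub>v n \<Longrightarrow> v = 0\<^sub>v n"
  obtains Bi where "mat_inverse B = Some Bi" "Bi \<in> carrier_mat n n" "B * Bi = 1\<^sub>m n" "Bi * B = 1\<^sub>m n"
proof -
  have "det B \<noteq> 0"
    using inj by (auto simp: det_0_iff_vec_prod_zero_field[OF B])
  from det_non_zero_imp_unit[OF B this, of "()"] have "mat_inverse B \<noteq> None"
    using mat_inverse(1)[OF B, of "()"] by blast
  then obtain Bi where "mat_inverse B = Some Bi"
    by blast
  with mat_inverse(2)[OF B this] that show thesis by blast
qed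

section \<open>The bilinear form and the inverse of its matrix\<close>

context glg
begin

text \<open>The bilinear form whose matrix in the Lagrange basis is \<open>B\<close>.\<close>

definition dg :: "real poly \<Rightarrow> real poly \<Rightarrow> real" where
  "dg p y = poly p 1 * poly y 1 - I01 (pderiv p * y)"

lemma dg_add_left: "dg (p + q) y = dg p y + dg q y"
  by (simp add: dg_def pderiv_add distrib_right I01_add algebra_simps flip: I01_add)

lemma dg_smult_left: "dg (Polynomial.smult c p) y = c * dg p y"
  by (simp add: dg_def pderiv_smult I01_smult algebra_simps)

lemma dg_add_right: "dg p (y + z) = dg p y + dg p z"
  by (simp add: dg_def distrib_left I01_add algebra_simps flip: I01_add)

lemma dg_smult_right: "dg p (Polynomial.smult c y) = c * dg p y"
  by (simp add: dg_def I01_smult algebra_simps)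

lemma dg_0 [simp]: "dg 0 y = 0" "dg p 0 = 0"
  by (simp_all add: dg_def)

lemma dg_sum_left: "dg (\<Sum>i\<in>A. f i) y = (\<Sum>i\<in>A. dg (f i) y)"
  by (induction A rule: infinite_finite_induct) (auto simp: dg_add_left)

lemma dg_sum_right: "dg p (\<Sum>i\<in>A. f i) = (\<Sum>i\<in>A. dg p (f i))"
  by (induction A rule: infinite_finite_induct) (auto simp: dg_add_right)

text \<open>Integration by parts trades the boundary value at 1 for the one at 0, where the initial
  value of the step enters.\<close>

lemma dg_by_parts: "dg p y = poly p 0 * poly y 0 + I01 (p * pderiv y)"
  using I01_by_parts[of p y] by (simp add: dg_def)

abbreviation "B \<equiv> ader_B M xi"
abbreviation "A \<equiv> ader_A M xi"

lemma B_carrier: "B \<in> carrier_mat (M + 1) (M + 1)"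
  by (simp add: ader_B_def)

lemma Lambda_carrier: "ader_Lambda M xi \<in> carrier_mat (M + 1) (M + 1)"
  by (simp add: ader_Lambda_def)

text \<open>The integrand \<open>pderiv p * y\<close> has degree at most \<open>2 * M\<close>,
  within the exactness range of the quadrature, so the discrete matrix and the integral form
  agree.\<close>

lemma dg_eq_Q:
  assumes "Polynomial.degree p \<le> M" "Polynomial.degree y \<le> M"
  shows "dg p y = poly p 1 * poly y 1 - (\<Sum>q\<le>M. w q * poly (pderiv p) (xi q) * poly y (xi q))"
proof -
  have "Polynomial.degree (pderiv p * y) \<le> Polynomial.degree (pderiv p) + Polynomial.degree y"
    by (rule degree_mult_le)
  with assms have "Polynomial.degree (pderiv p * y) \<le> 2 * M + 1"
    by (simp add: degree_pderiv)
  from Q_exact[OF this] show ?thesis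
    by (simp add: dg_def Q_def mult_ac)
qed

lemma B_entry: "l \<le> M \<Longrightarrow> m \<le> M \<Longrightarrow> B $$ (l, m) = dg (psi l) (psi m)"
  by (simp add: ader_B_def dg_eq_Q degree_psi)

lemma Lambda_entry:
  "l \<le> M \<Longrightarrow> m \<le> M \<Longrightarrow> ader_Lambda M xi $$ (l, m) = (if l = m then w l else 0)"
  by (auto simp: ader_Lambda_def poly_psi if_distrib cong: if_cong intro: sum.neutral)

lemma sum_B:
  assumes "l \<le> M"
  shows "(\<Sum>m\<le>M. B $$ (l, m) * d m) = dg (psi l) (\<Sum>m\<le>M. Polynomial.smult (d m) (psi m))"
  using assms by (simp add: dg_sum_right dg_smult_right B_entry mult_ac)

lemma dg_interp:
  assumes "Polynomial.degree p \<le> M"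
  shows "dg p y = (\<Sum>l\<le>M. poly p (xi l) * dg (psi l) y)"
  by (subst interpolation[OF assms]) (simp add: dg_sum_left dg_smult_left)

text \<open>Testing with \<open>y\<close> itself gives \<open>y(1)\<^sup>2 + y(0)\<^sup>2 = 0\<close>; testing with \<open>y'\<close> then gives \<open>y' = 0\<close>.\<close>

lemma dg_nondegenerate:
  assumes deg: "Polynomial.degree y \<le> M" and 0: "\<And>l. l \<le> M \<Longrightarrow> dg (psi l) y = 0"
  shows "y = 0"
proof -
  have dg0: "dg p y = 0" if "Polynomial.degree p \<le> M" for p
    using dg_interp[OF that, of y] 0 by simp
  have "poly y 1 * poly y 1 = I01 (pderiv y * y)"
    using dg0[OF deg] by (simp add: dg_def)
  moreover have "poly y 0 * poly y 0 = - I01 (pderiv y * y)"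
    using dg0[OF deg] by (simp add: dg_by_parts mult.commute)
  ultimately have "poly y 0 * poly y 0 + poly y 1 * poly y 1 = 0" by simp
  then have y0: "poly y 0 = 0" and y1: "poly y 1 = 0"
    by (auto simp: add_nonneg_eq_0_iff)
  have "dg (pderiv y) y = 0"
    using deg by (intro dg0) (simp add: degree_pderiv)
  then have "I01 (pderiv y * pderiv y) = 0"
    by (simp add: dg_by_parts y0)
  then have "pderiv y = 0" by (rule I01_square_eq_0)
  then obtain c where "y = [:c:]"
    by (auto simp: pderiv_eq_0_iff elim: degree_eq_zeroE)
  with y0 show ?thesis by simp
qed

text \<open>Read \<open>v\<close> as the nodal values of a polynomial of degree at most
  \<open>M\<close>. Then \<open>B\<close> applied to \<open>v\<close> lists the values of
  \<open>dg\<close> against all basis polynomials, and \<open>dg_nondegenerate\<close>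
  applies.\<close>

lemma B_injective:
  assumes v: "v \<in> carrier_vec (M + 1)" and Bv: "B *\<^sub>v v = 0\<^sub>v (M + 1)"
  shows "v = 0\<^sub>v (M + 1)"
proof -
  let ?y = "\<Sum>m\<le>M. Polynomial.smult (vec_index v m) (psi m)"
  have "dg (psi l) ?y = 0" if l: "l \<le> M" for l
  proof -
    have "vec_index (B *\<^sub>v v) l = (\<Sum>m\<le>M. B $$ (l, m) * vec_index v m)"
      using l v B_carrier by (auto simp: scalar_prod_def atLeast0LessThan lessThan_Suc_atMost)
    then show ?thesis using l by (simp add: sum_B Bv)
  qed
  then have y0: "?y = 0"
    by (intro dg_nondegenerate degree_lincomb_psi)
  have "vec_index v m = 0" if "m \<le> M" for m
    using poly_lincomb_psi[OF that, of "vec_index v"] unfolding y0 by simp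
  then show ?thesis using v by (intro eq_vecI) auto
qed

definition Bi :: "real mat" where "Bi = the (mat_inverse B)"

lemma Bi: "Bi \<in> carrier_mat (M + 1) (M + 1)" "B * Bi = 1\<^sub>m (M + 1)" "Bi * B = 1\<^sub>m (M + 1)"
  by (rule ex_mat_inverse[OF B_carrier B_injective]; simp add: Bi_def)+

lemma B_invertible: "invertible_mat B"
  using Bi B_carrier unfolding invertible_mat_def inverts_mat_def by (auto simp: square_mat.simps)

lemma B_Bi: "l \<le> M \<Longrightarrow> r \<le> M \<Longrightarrow> (\<Sum>s\<le>M. B $$ (l, s) * Bi $$ (s, r)) = (if l = r then 1 else 0)"
  using arg_cong[OF Bi(2), of "\<lambda>X. X $$ (l, r)"] Bi(1) B_carrier
  by (auto simp: scalar_prod_def atLeast0LessThan lessThan_Suc_atMost)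

lemma Bi_B: "l \<le> M \<Longrightarrow> r \<le> M \<Longrightarrow> (\<Sum>s\<le>M. Bi $$ (l, s) * B $$ (s, r)) = (if l = r then 1 else 0)"
  using arg_cong[OF Bi(3), of "\<lambda>X. X $$ (l, r)"] Bi(1) B_carrier
  by (auto simp: scalar_prod_def atLeast0LessThan lessThan_Suc_atMost)

text \<open>\<open>ader_Lambda\<close> is diagonal with the weights as entries, so it only scales
  the columns of the inverse.\<close>

lemma A_entry: "s \<le> M \<Longrightarrow> r \<le> M \<Longrightarrow> A $$ (s, r) = Bi $$ (s, r) * w r"
  using Bi(1) Lambda_carrier
  by (auto simp: ader_A_def Bi_def[symmetric] scalar_prod_def atLeast0LessThan lessThan_Suc_atMost
      Lambda_entry if_distrib sum.delta cong: if_cong)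

section \<open>Weak form and stage order\<close>

lemma dg_const_right: "dg p [:c:] = c * poly p 0"
  by (simp add: dg_by_parts)

text \<open>Multiplication by \<open>B\<close> cancels \<open>Bi\<close> in \<open>A\<close> and
  leaves the weights: the interpolant of the stages satisfies a \<open>dg\<close> equation against
  every \<open>psi l\<close>, hence against every \<open>p\<close> of degree at most
  \<open>M\<close>. The form is scalar because it is applied to one component at a time.\<close>

lemma weak_form:
  assumes y: "\<And>s. s \<le> M \<Longrightarrow> y s = un + h * (\<Sum>r\<le>M. A $$ (s, r) * g r)"
    and U: "U = un + h * (\<Sum>r\<le>M. w r * g r)"
    and p: "Polynomial.degree p \<le> M"
  shows "poly p 1 * U = poly p 0 * un +
    (\<Sum>q\<le>M. w q * (poly (pderiv p) (xi q) * y q + h * poly p (xi q) * g q))"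
proof -
  let ?y = "\<Sum>m\<le>M. Polynomial.smult (y m) (psi m)"
  have psi_y: "dg (psi l) ?y = un * poly (psi l) 0 + h * (w l * g l)" if l: "l \<le> M" for l
  proof -
    \<comment> \<open>The basis polynomials sum to 1, so the \<open>un\<close> part of the stages is
      a constant polynomial and contributes \<open>un\<close> times
      \<open>poly (psi l) 0\<close>.\<close>
    have one: "(\<Sum>m\<le>M. Polynomial.smult 1 (psi m)) = [:1:]"
      using interpolation[of "[:1:]"] by simp
    have "(\<Sum>m\<le>M. B $$ (l, m) * (\<Sum>r\<le>M. A $$ (m, r) * g r)) =
        (\<Sum>m\<le>M. \<Sum>r\<le>M. B $$ (l, m) * Bi $$ (m, r) * (w r * g r))"
      by (simp add: sum_distrib_left A_entry mult_ac)
    also have "\<dots> = (\<Sum>r\<le>M. (\<Sum>m\<le>M. B $$ (l, m) * Bi $$ (m, r)) * (w r * g r))"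
      by (subst sum.swap) (simp add: sum_distrib_right)
    also have "\<dots> = w l * g l"
      using l by (simp add: B_Bi if_distrib[of "\<lambda>x. x * _"] sum.delta cong: if_cong)
    finally have BA: "(\<Sum>m\<le>M. B $$ (l, m) * (\<Sum>r\<le>M. A $$ (m, r) * g r)) = w l * g l" .
    have "dg (psi l) ?y = (\<Sum>m\<le>M. B $$ (l, m) * y m)"
      by (simp add: sum_B[OF l])
    also have "\<dots> = (\<Sum>m\<le>M. un * (B $$ (l, m) * 1) + h * (B $$ (l, m) * (\<Sum>r\<le>M. A $$ (m, r) * g r)))"
      by (intro sum.cong refl) (simp add: y algebra_simps)
    also have "\<dots> = un * (\<Sum>m\<le>M. B $$ (l, m) * 1) + h * (w l * g l)"
      unfolding sum.distrib sum_distrib_left[symmetric] BA ..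
    finally show ?thesis
      unfolding sum_B[OF l] one by (simp add: dg_const_right)
  qed
  have *: "dg p ?y = un * poly p 0 + h * (\<Sum>l\<le>M. w l * (poly p (xi l) * g l))"
    if p: "Polynomial.degree p \<le> M" for p
  proof -
    have "poly p 0 = (\<Sum>l\<le>M. poly p (xi l) * poly (psi l) 0)"
      by (subst (1) interpolation[OF p]) (simp add: poly_sum)
    moreover have "dg p ?y = (\<Sum>l\<le>M. poly p (xi l) * (un * poly (psi l) 0 + h * (w l * g l)))"
      unfolding dg_interp[OF p, of ?y] by (intro sum.cong refl) (simp add: psi_y)
    ultimately show ?thesis
      by (simp add: algebra_simps sum.distrib sum_distrib_left)
  qed
  \<comment> \<open>Testing with the constant 1 identifies the result of the step with the value at
    1 of the polynomial interpolating the stages.\<close>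
  have "poly ?y 1 = U"
    using *[of "[:1:]"] by (simp add: dg_def U)
  then have "poly p 1 * U = dg p ?y + (\<Sum>q\<le>M. w q * poly (pderiv p) (xi q) * y q)"
    unfolding dg_eq_Q[OF p degree_lincomb_psi] by (simp add: poly_lincomb_psi)
  also have "\<dots> = poly p 0 * un +
    (\<Sum>q\<le>M. w q * (poly (pderiv p) (xi q) * y q + h * poly p (xi q) * g q))"
    unfolding *[OF p] by (simp add: algebra_simps sum.distrib sum_distrib_left)
  finally show ?thesis .
qed

text \<open>After subtraction of its value at 0, \<open>p\<close> has only the term
  \<open>I01 (psi l * pderiv p)\<close> left in the \<open>dg\<close> form, and exact quadrature
  turns this into \<open>w l\<close> times a nodal value of \<open>pderiv p\<close>. So
  \<open>B\<close> maps the nodal values of \<open>x\<close> to \<open>ader_Lambda\<close> applied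
  to those of the derivative; inverting \<open>B\<close> gives the claim.\<close>

lemma stage_order:
  assumes p: "Polynomial.degree p \<le> M" and s: "s \<le> M"
  shows "(\<Sum>r\<le>M. A $$ (s, r) * poly (pderiv p) (xi r)) = poly p (xi s) - poly p 0"
proof -
  define x where "x = p - [:poly p 0:]"
  have dx: "Polynomial.degree x \<le> M" and x0: "poly x 0 = 0" and x': "pderiv x = pderiv p"
    unfolding x_def using p by (auto simp: pderiv_diff intro: degree_diff_le)
  have row: "(\<Sum>m\<le>M. B $$ (l, m) * poly x (xi m)) = w l * poly (pderiv p) (xi l)" if l: "l \<le> M" for l
  proof -
    have "(\<Sum>m\<le>M. B $$ (l, m) * poly x (xi m)) = I01 (psi l * pderiv p)"
      unfolding sum_B[OF l] interpolation[OF dx, symmetric] by (simp add: dg_by_parts x0 x')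
    also have "\<dots> = Q (psi l * pderiv p)"
    proof (rule Q_exact)
      have "Polynomial.degree (psi l * pderiv p) \<le> Polynomial.degree (psi l) + Polynomial.degree (pderiv p)"
        by (rule degree_mult_le)
      with degree_psi[OF l] p show "Polynomial.degree (psi l * pderiv p) \<le> 2 * M + 1"
        by (simp add: degree_pderiv)
    qed
    also have "\<dots> = (\<Sum>q\<le>M. if q = l then w l * poly (pderiv p) (xi l) else 0)"
      unfolding Q_def using l by (intro sum.cong refl) (simp add: poly_psi)
    finally show ?thesis using l by simp
  qed
  have "(\<Sum>r\<le>M. A $$ (s, r) * poly (pderiv p) (xi r)) =
      (\<Sum>l\<le>M. \<Sum>m\<le>M. Bi $$ (s, l) * B $$ (l, m) * poly x (xi m))"
    using s by (intro sum.cong refl)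
      (simp add: A_entry mult.assoc sum_distrib_left[symmetric] row del: sum_distrib_left)
  also have "\<dots> = (\<Sum>m\<le>M. (\<Sum>l\<le>M. Bi $$ (s, l) * B $$ (l, m)) * poly x (xi m))"
    by (subst sum.swap) (simp add: sum_distrib_right)
  also have "\<dots> = poly x (xi s)"
    using s by (simp add: Bi_B if_distrib[of "\<lambda>x. x * _"] sum.delta cong: if_cong)
  finally show ?thesis by (simp add: x_def)
qed

end

section \<open>Smooth functions along a solution\<close>

lemma Ck_SucD: "Ck (Suc k) f \<Longrightarrow> Ck k f"
proof (induction k arbitrary: f)
  case 0
  then show ?case
    by (auto intro!: continuous_at_imp_continuous_on intro: has_derivative_continuous)
next
  case (Suc k)
  obtain f' where "\<forall>x. (f has_derivative f' x) (at x)" and f': "\<And>v. Ck (Suc k) (\<lambda>x. f' x v)"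
    using iffD1[OF Ck.simps(2) Suc.prems] by blast
  moreover have "\<forall>v. Ck k (\<lambda>x. f' x v)"
    using Suc.IH[OF f'] by blast
  ultimately show ?case
    unfolding Ck.simps(2)[of k f] by blast
qed

lemma Ck_mono: "m \<le> n \<Longrightarrow> Ck n f \<Longrightarrow> Ck m f"
proof (induction n rule: dec_induct)
  case (step k)
  then show ?case by (metis Ck_SucD)
qed

lemma Ck_imp_continuous: "Ck k f \<Longrightarrow> continuous_on UNIV f"
  using Ck_mono[of 0 k f] by simp

lemma Ck_const: "Ck k (\<lambda>_. c)"
proof (induction k arbitrary: c)
  case (Suc k)
  show ?case by (auto intro!: exI[of _ "\<lambda>_ _. 0"] Suc)
qed simp

lemma Ck_add: "Ck k f \<Longrightarrow> Ck k g \<Longrightarrow> Ck k (\<lambda>x. f x + g x)"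
proof (induction k arbitrary: f g)
  case (Suc k)
  obtain f' g' where "\<forall>x. (f has_derivative f' x) (at x)" "\<forall>v. Ck k (\<lambda>x. f' x v)"
    "\<forall>x. (g has_derivative g' x) (at x)" "\<forall>v. Ck k (\<lambda>x. g' x v)"
    using Suc.prems by auto
  with Suc.IH show ?case
    by (auto intro!: exI[of _ "\<lambda>x v. f' x v + g' x v"] has_derivative_add)
qed (auto intro: continuous_on_add)

lemma Ck_sum: "(\<And>i. i \<in> I \<Longrightarrow> Ck k (f i)) \<Longrightarrow> Ck k (\<lambda>x. \<Sum>i\<in>I. f i x)"
  by (induction I rule: infinite_finite_induct) (auto simp: Ck_const Ck_add simp del: Ck.simps)

lemma Ck_mult:
  fixes f g :: "'a::real_normed_vector \<Rightarrow> real"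
  shows "Ck k f \<Longrightarrow> Ck k g \<Longrightarrow> Ck k (\<lambda>x. f x * g x)"
proof (induction k arbitrary: f g)
  case (Suc k)
  obtain f' g' where f': "\<forall>x. (f has_derivative f' x) (at x)" "\<forall>v. Ck k (\<lambda>x. f' x v)"
    and g': "\<forall>x. (g has_derivative g' x) (at x)" "\<forall>v. Ck k (\<lambda>x. g' x v)"
    using Suc.prems by auto
  have "((\<lambda>x. f x * g x) has_derivative (\<lambda>v. f x * g' x v + f' x v * g x)) (at x)" for x
    using f' g' by (intro has_derivative_mult) auto
  moreover have "Ck k (\<lambda>x. f x * g' x v + f' x v * g x)" for v
    using f' g' Suc.prems by (intro Ck_add Suc.IH) (auto dest: Ck_SucD simp del: Ck.simps)
  ultimately show ?case
    by (auto intro!: exI[of _ "\<lambda>x v. f x * g' x v + f' x v * g x"])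
qed (auto intro: continuous_on_mult)

lemma Ck_bounded_linear: "bounded_linear f \<Longrightarrow> Ck k f"
proof (cases k)
  case 0
  assume "bounded_linear f"
  then show ?thesis using 0 by (auto intro: linear_continuous_on)
next
  case (Suc m)
  assume "bounded_linear f"
  then show ?thesis
    unfolding Suc by (auto intro!: exI[of _ "\<lambda>_. f"] bounded_linear_imp_has_derivative Ck_const)
qed

lemma Ck_compose_bounded_linear:
  assumes "bounded_linear L"
  shows "Ck k f \<Longrightarrow> Ck k (\<lambda>x. L (f x))"
proof (induction k arbitrary: f)
  case 0
  then show ?case
    using bounded_linear.continuous_on[OF assms] by auto
next
  case (Suc k)
  obtain f' where f': "\<forall>x. (f has_derivative f' x) (at x)" "\<forall>v. Ck k (\<lambda>x. f' x v)"
    using Suc.prems by auto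
  then show ?case
    using Suc.IH by (auto intro!: exI[of _ "\<lambda>x v. L (f' x v)"] bounded_linear.has_derivative[OF assms])
qed

lemma linear_snd_expand:
  fixes f :: "real \<times> 'v::euclidean_space \<Rightarrow> real"
  assumes "linear f"
  shows "f (0, d) = (\<Sum>b\<in>Basis. inner d b * f (0, b))"
proof -
  have "(0, d) = (\<Sum>b\<in>Basis. inner d b *\<^sub>R (0 :: real, b))"
    by (simp add: prod_eq_iff fst_sum snd_sum euclidean_representation)
  then have "f (0, d) = f (\<Sum>b\<in>Basis. inner d b *\<^sub>R (0, b))"
    by (rule arg_cong)
  also have "\<dots> = (\<Sum>b\<in>Basis. f (inner d b *\<^sub>R (0, b)))"
    by (rule linear_sum[OF assms])
  also have "\<dots> = (\<Sum>b\<in>Basis. inner d b * f (0, b))"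
    by (simp only: linear_scale[OF assms] real_scaleR_def)
  finally show ?thesis .
qed

text \<open>The witness is \<open>F\<^sub>1 = \<partial>\<^sub>t F + \<Sum>\<^sub>b G\<^sub>b \<partial>\<^sub>b F\<close>.\<close>

lemma derivative_along_solution:
  fixes F :: "real \<times> (real ^ 'q::finite) \<Rightarrow> real"
  assumes G: "Ck n (\<lambda>(t, v). G t v)" and F: "Ck (Suc n) F" and u: "ode_solution G u"
  obtains F1 where "Ck n F1" "\<And>s. ((\<lambda>s. F (s, u s)) has_real_derivative F1 (s, u s)) (at s)"
proof -
  obtain F' where F': "\<And>x. (F has_derivative F' x) (at x)" "\<And>v. Ck n (\<lambda>x. F' x v)"
    using F by auto
  define F1 where "F1 = (\<lambda>x. F' x (1, 0) +
    (\<Sum>b\<in>Basis. inner ((\<lambda>(t, v). G t v) x) b * F' x (0, b)))"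
  show thesis
  proof
    show "Ck n F1"
      unfolding F1_def
      by (intro Ck_add Ck_sum Ck_mult F' Ck_compose_bounded_linear[OF bounded_linear_inner_left G])
    fix s
    have u': "(u has_derivative (\<lambda>h. h *\<^sub>R G s (u s))) (at s)"
      using u by (simp add: ode_solution_def has_vector_derivative_def)
    have "((\<lambda>s. (s, u s)) has_derivative (\<lambda>h. (h, h *\<^sub>R G s (u s)))) (at s)"
      by (intro has_derivative_Pair u' has_derivative_ident)
    then have "((\<lambda>s. F (s, u s)) has_derivative (\<lambda>h. F' (s, u s) (h, h *\<^sub>R G s (u s)))) (at s)"
      using F'(1) by (rule has_derivative_compose)
    moreover have lin: "linear (F' (s, u s))"
      using F'(1) has_derivative_linear by blast
    have "F' (s, u s) (h, h *\<^sub>R G s (u s)) = F1 (s, u s) * h" for h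
    proof -
      have "F' (s, u s) (h, h *\<^sub>R G s (u s)) = F' (s, u s) (h *\<^sub>R ((1, 0) + (0, G s (u s))))"
        by simp
      also have "\<dots> = h *\<^sub>R (F' (s, u s) (1, 0) + F' (s, u s) (0, G s (u s)))"
        unfolding linear_scale[OF lin] linear_add[OF lin] ..
      also have "\<dots> = F1 (s, u s) * h"
        unfolding linear_snd_expand[OF lin, of "G s (u s)"] F1_def by simp
      finally show ?thesis .
    qed
    ultimately show "((\<lambda>s. F (s, u s)) has_real_derivative F1 (s, u s)) (at s)"
      by (simp add: has_field_derivative_def)
  qed
qed

section \<open>Polynomial expansions to the right of 0\<close>

lemma bigo_antiderivative:
  fixes f :: "real \<Rightarrow> real"
  assumes f: "\<And>s. (f has_real_derivative f' s) (at s)" and 0: "f 0 = 0"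
    and f': "f' \<in> O[at_right 0](\<lambda>s. s ^ n)"
  shows "f \<in> O[at_right 0](\<lambda>s. s ^ Suc n)"
proof -
  obtain c where c: "c > 0" "\<forall>\<^sub>F s in at_right 0. norm (f' s) \<le> c * norm (s ^ n)"
    using landau_o.bigE[OF f'] by blast
  then obtain b where b: "b > 0" "\<And>s. 0 < s \<Longrightarrow> s < b \<Longrightarrow> \<bar>f' s\<bar> \<le> c * s ^ n"
    unfolding eventually_at_right_field by auto
  have "\<bar>f s\<bar> \<le> c * s ^ Suc n" if s: "0 < s" "s < b" for s
  proof -
    \<comment> \<open>The mean value theorem supplies the extra factor \<open>s\<close>; since
      \<open>z < s\<close>, the bound at \<open>z\<close> may be replaced by the one at
      \<open>s\<close>.\<close>
    obtain z where z: "0 < z" "z < s" "f s - f 0 = (s - 0) * f' z"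
      using MVT2[OF s(1), of f f'] f by auto
    have "\<bar>f s\<bar> = s * \<bar>f' z\<bar>"
      using z s 0 by (simp add: abs_mult)
    also have "\<dots> \<le> s * (c * z ^ n)"
      using z s b by (intro mult_left_mono) auto
    also have "\<dots> \<le> s * (c * s ^ n)"
      using z s c by (intro mult_left_mono power_mono) auto
    finally show ?thesis by (simp add: mult_ac)
  qed
  then show ?thesis
    using b(1) by (intro bigoI[of _ c]) (auto simp: eventually_at_right_field)
qed

lemma isCont_imp_bigo_1:
  fixes f :: "real \<Rightarrow> real"
  assumes "isCont f 0"
  shows "f \<in> O[at_right 0](\<lambda>_. 1)"
proof (rule bigoI_tendsto_norm)
  have "(f \<longlongrightarrow> f 0) (at_right 0)"
    using assms by (auto simp: isCont_def intro: filterlim_mono at_le)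
  then show "((\<lambda>x. norm (f x / 1)) \<longlongrightarrow> norm (f 0)) (at_right 0)"
    by (auto intro: tendsto_intros)
qed simp

lemma poly_bigo_1: "poly p \<in> O[at_right (0::real)](\<lambda>_. 1)"
  by (intro isCont_imp_bigo_1 poly_isCont)

lemma power_bigo_power:
  assumes "m \<le> n"
  shows "(\<lambda>s::real. s ^ n) \<in> O[at_right 0](\<lambda>s. s ^ m)"
proof (rule bigoI[of _ 1])
  have "\<forall>\<^sub>F s in at_right 0. s \<in> {0<..<1 :: real}"
    by (rule eventually_at_right_real) simp
  then show "\<forall>\<^sub>F s::real in at_right 0. norm (s ^ n) \<le> 1 * norm (s ^ m)"
    by eventually_elim (use assms in \<open>auto intro: power_decreasing\<close>)
qed

lemma power_dvd_bigo:
  assumes "[:0, 1:] ^ n dvd p"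
  shows "poly p \<in> O[at_right (0::real)](\<lambda>s. s ^ n)"
proof -
  obtain q where "p = [:0, 1:] ^ n * q" using assms by blast
  then have "poly p = (\<lambda>s. s ^ n * poly q s)" by auto
  then show ?thesis
    using landau_o.big.mult[OF landau_o.big_refl poly_bigo_1[of q]] by simp
qed

text \<open>A Taylor expansion of order \<open>n\<close> at 0, seen from the right. The degree of
  the polynomial is left free, which keeps the notion closed under products;
  \<open>poly_expansion_truncate\<close> restores a degree bound.\<close>

definition poly_expansion :: "nat \<Rightarrow> (real \<Rightarrow> real) \<Rightarrow> bool" where
  "poly_expansion n f \<longleftrightarrow> (\<exists>p. (\<lambda>s. f s - poly p s) \<in> O[at_right 0](\<lambda>s. s ^ n))"

lemma poly_expansion_poly: "poly_expansion n (poly p)"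
  unfolding poly_expansion_def by (rule exI[of _ p]) simp

lemma poly_expansion_bounded:
  assumes "poly_expansion n f"
  shows "f \<in> O[at_right 0](\<lambda>_. 1)"
proof -
  obtain p where "(\<lambda>s. f s - poly p s) \<in> O[at_right 0](\<lambda>s. s ^ n)"
    using assms by (auto simp: poly_expansion_def)
  then have "(\<lambda>s. f s - poly p s) \<in> O[at_right 0](\<lambda>s. s ^ 0)"
    using landau_o.big_trans power_bigo_power[of 0 n] by blast
  then have "(\<lambda>s. (f s - poly p s) + poly p s) \<in> O[at_right 0](\<lambda>_. 1)"
    by (intro sum_in_bigo(1) poly_bigo_1) simp
  then show ?thesis by simp
qed

lemma poly_expansion_add:
  assumes "poly_expansion n f" "poly_expansion n g"
  shows "poly_expansion n (\<lambda>s. f s + g s)"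
proof -
  obtain p q where "(\<lambda>s. f s - poly p s) \<in> O[at_right 0](\<lambda>s. s ^ n)"
    "(\<lambda>s. g s - poly q s) \<in> O[at_right 0](\<lambda>s. s ^ n)"
    using assms by (auto simp: poly_expansion_def)
  from sum_in_bigo(1)[OF this] have "(\<lambda>s. (f s + g s) - poly (p + q) s) \<in> O[at_right 0](\<lambda>s. s ^ n)"
    by (simp add: algebra_simps)
  then show ?thesis unfolding poly_expansion_def by blast
qed

text \<open>The error of the product of the expansions splits as (f - p) g + p (g - q), where
  \<open>g\<close> and \<open>p\<close> are bounded near 0.\<close>

lemma poly_expansion_mult:
  assumes "poly_expansion n f" "poly_expansion n g"
  shows "poly_expansion n (\<lambda>s. f s * g s)"
proof -
  obtain p q where p: "(\<lambda>s. f s - poly p s) \<in> O[at_right 0](\<lambda>s. s ^ n)"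
    and q: "(\<lambda>s. g s - poly q s) \<in> O[at_right 0](\<lambda>s. s ^ n)"
    using assms by (auto simp: poly_expansion_def)
  have "(\<lambda>s. (f s - poly p s) * g s + poly p s * (g s - poly q s)) \<in> O[at_right 0](\<lambda>s. s ^ n)"
    using landau_o.big.mult[OF p poly_expansion_bounded[OF assms(2)]]
      landau_o.big.mult[OF poly_bigo_1[of p] q]
    by (intro sum_in_bigo) auto
  then have "(\<lambda>s. f s * g s - poly (p * q) s) \<in> O[at_right 0](\<lambda>s. s ^ n)"
    by (simp add: algebra_simps)
  then show ?thesis unfolding poly_expansion_def by blast
qed

text \<open>Reduction modulo the power \<open>Suc m\<close> of the variable discards only terms that
  the error bound already absorbs.\<close>

lemma poly_expansion_truncate:
  assumes "poly_expansion (Suc m) f"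
  obtains p where "Polynomial.degree p \<le> m" "(\<lambda>s. f s - poly p s) \<in> O[at_right 0](\<lambda>s. s ^ Suc m)"
proof -
  obtain p where p: "(\<lambda>s. f s - poly p s) \<in> O[at_right 0](\<lambda>s. s ^ Suc m)"
    using assms by (auto simp: poly_expansion_def)
  define X where "X = ([:0, 1:] :: real poly) ^ Suc m"
  have X: "X \<noteq> 0" "Polynomial.degree X = Suc m"
    unfolding X_def by (simp_all add: degree_power_eq del: power_Suc)
  show thesis
  proof
    show "Polynomial.degree (p mod X) \<le> m"
      using degree_mod_less[OF X(1), of p] X(2) by auto
    have "X dvd p - p mod X" by (rule dvd_minus_mod)
    then have "poly (p - p mod X) \<in> O[at_right 0](\<lambda>s. s ^ Suc m)"
      unfolding X_def by (rule power_dvd_bigo)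
    from sum_in_bigo(1)[OF p this]
    show "(\<lambda>s. f s - poly (p mod X) s) \<in> O[at_right 0](\<lambda>s. s ^ Suc m)"
      by simp
  qed
qed

lemma poly_expansion_antiderivative:
  assumes f: "\<And>s. (f has_real_derivative f' s) (at s)" and f': "poly_expansion n f'"
  shows "poly_expansion (Suc n) f"
proof -
  obtain p where p: "(\<lambda>s. f' s - poly p s) \<in> O[at_right 0](\<lambda>s. s ^ n)"
    using f' by (auto simp: poly_expansion_def)
  obtain P where P: "pderiv P = p" "poly P 0 = 0"
    by (rule poly_antiderivative)
  have "(\<lambda>s. f s - (f 0 + poly P s)) \<in> O[at_right 0](\<lambda>s. s ^ Suc n)"
  proof (rule bigo_antiderivative[OF _ _ p])
    show "((\<lambda>s. f s - (f 0 + poly P s)) has_real_derivative f' s - poly p s) (at s)" for s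
      using P by (auto intro!: derivative_eq_intros f)
  qed (simp add: P)
  then have "(\<lambda>s. f s - poly ([:f 0:] + P) s) \<in> O[at_right 0](\<lambda>s. s ^ Suc n)"
    by simp
  then show ?thesis unfolding poly_expansion_def by blast
qed

lemma ode_solution_continuous:
  assumes "ode_solution G u"
  shows "continuous_on UNIV u"
  using assms has_vector_derivative_continuous
  unfolding ode_solution_def continuous_on_eq_continuous_at[OF open_UNIV] by blast

text \<open>The derivative of \<open>F\<close> along the solution is again a function of time and
  state, one class less smooth. Induction expands that derivative, and integration gains one order,
  so higher derivatives of \<open>u\<close> never have to be written down.\<close>

lemma poly_expansion_along_solution:
  fixes F :: "real \<times> (real ^ 'q::finite) \<Rightarrow> real"
  assumes G: "Ck n (\<lambda>(t, v). G t v)" and F: "Ck n F" and u: "ode_solution G u"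
  shows "poly_expansion n (\<lambda>s. F (t + s, u (t + s)))"
  using G F
proof (induction n arbitrary: F)
  case 0
  have "continuous_on UNIV (\<lambda>s. u (t + s))"
    by (rule continuous_on_compose2[OF ode_solution_continuous[OF u]]) (auto intro: continuous_intros)
  then have "continuous_on UNIV (\<lambda>s. (t + s, u (t + s)))"
    by (intro continuous_intros)
  then have "continuous_on UNIV (\<lambda>s. F (t + s, u (t + s)))"
    by (rule continuous_on_compose2[OF Ck_imp_continuous[OF 0(2)]]) simp
  then have "(\<lambda>s. F (t + s, u (t + s))) \<in> O[at_right 0](\<lambda>_. 1)"
    by (intro isCont_imp_bigo_1) (simp add: continuous_on_eq_continuous_at)
  then show ?case
    unfolding poly_expansion_def by (intro exI[of _ 0]) simp
next
  case (Suc n)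
  obtain F1 where F1: "Ck n F1" "\<And>s. ((\<lambda>s. F (s, u s)) has_real_derivative F1 (s, u s)) (at s)"
    using derivative_along_solution[OF Ck_SucD Suc.prems(2) u] Suc.prems(1) by blast
  have "((\<lambda>s. F (t + s, u (t + s))) has_real_derivative F1 (t + s, u (t + s))) (at s)" for s
    using DERIV_shift[of "\<lambda>s. F (s, u s)" "F1 (t + s, u (t + s))" s t] F1(2)[of "t + s"]
    by (simp add: add.commute)
  moreover have "poly_expansion n (\<lambda>s. F1 (t + s, u (t + s)))"
    using Suc.prems(1) by (intro Suc.IH F1) (auto dest: Ck_SucD simp del: Ck.simps)
  ultimately show ?case by (rule poly_expansion_antiderivative)
qed

section \<open>Linearization and the adjoint equation\<close>

text \<open>A second-order Taylor bound in the state variable, with \<open>J b\<close> the partial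
  derivative in direction \<open>b\<close>. Compactness of \<open>K\<close> bounds the second
  partial derivatives, and convexity keeps the connecting segment inside \<open>K\<close>.\<close>

lemma Ck_linearization:
  fixes F :: "real \<times> 'v::euclidean_space \<Rightarrow> real"
  assumes "Ck (Suc (Suc n)) F"
  obtains J where "\<And>b. Ck (Suc n) (J b)"
    "\<And>K. compact K \<Longrightarrow> convex K \<Longrightarrow> \<exists>C. \<forall>t v d. (t, v) \<in> K \<longrightarrow> (t, v + d) \<in> K \<longrightarrow>
       \<bar>F (t, v + d) - F (t, v) - (\<Sum>b\<in>Basis. inner d b * J b (t, v))\<bar> \<le> C * (norm d)\<^sup>2"
proof -
  obtain F' where F': "\<And>x. (F has_derivative F' x) (at x)" "\<And>v. Ck (Suc n) (\<lambda>x. F' x v)"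
    using assms Ck.simps(2)[of "Suc n" F] by blast
  define J where "J = (\<lambda>b x. F' x (0, b))"
  have "\<forall>b. \<exists>J'. (\<forall>x. (J b has_derivative J' x) (at x)) \<and> (\<forall>v. Ck n (\<lambda>x. J' x v))"
    unfolding J_def using F'(2) by simp
  then obtain J' where J': "\<And>b x. (J b has_derivative J' b x) (at x)" "\<And>b v. Ck n (\<lambda>x. J' b x v)"
    by metis
  show thesis
  proof
    show "Ck (Suc n) (J b)" for b unfolding J_def by (rule F')
  next
    fix K :: "(real \<times> 'v) set"
    assume K: "compact K" "convex K"
    have "\<exists>C. \<forall>x\<in>K. \<bar>J' b x (0, c)\<bar> \<le> C" for b c
    proof -
      have "compact ((\<lambda>x. J' b x (0, c)) ` K)"
        using Ck_imp_continuous[OF J'(2)] K continuous_on_subset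
        by (intro compact_continuous_image) blast+
      then show ?thesis
        by (auto dest!: compact_imp_bounded simp: bounded_iff)
    qed
    then obtain C where C: "\<And>b c x. x \<in> K \<Longrightarrow> \<bar>J' b x (0, c)\<bar> \<le> C b c"
      by metis
    show "\<exists>C. \<forall>t v d. (t, v) \<in> K \<longrightarrow> (t, v + d) \<in> K \<longrightarrow>
       \<bar>F (t, v + d) - F (t, v) - (\<Sum>b\<in>Basis. inner d b * J b (t, v))\<bar> \<le> C * (norm d)\<^sup>2"
    proof (intro exI allI impI)
      fix t v d
      assume x: "(t, v) \<in> K" and xd: "(t, v + d) \<in> K"
      let ?x = "\<lambda>r::real. (t, v + r *\<^sub>R d)"
      have xK: "?x r \<in> K" if "0 \<le> r" "r \<le> 1" for r
      proof -
        have "?x r = (1 - r) *\<^sub>R (t, v) + r *\<^sub>R (t, v + d)"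
          by (simp add: algebra_simps)
        then show ?thesis
          using convexD[OF K(2) x xd, of "1 - r" r] that by simp
      qed
      have x': "(?x has_derivative (\<lambda>h. (0, h *\<^sub>R d))) (at r)" for r
        by (auto intro!: derivative_eq_intros)
      have dir: "((\<lambda>r. H (?x r)) has_real_derivative (\<Sum>b\<in>Basis. inner d b * H' (?x r) (0, b))) (at r)"
        if H: "\<And>x. (H has_derivative H' x) (at x)" for H :: "real \<times> 'v \<Rightarrow> real" and H' r
      proof -
        have lin: "linear (H' (?x r))"
          using H has_derivative_linear by blast
        have "((\<lambda>r. H (?x r)) has_derivative (\<lambda>h. H' (?x r) (0, h *\<^sub>R d))) (at r)"
          by (rule has_derivative_compose[OF x' H])
        moreover have "H' (?x r) (0, h *\<^sub>R d) = (\<Sum>b\<in>Basis. inner d b * H' (?x r) (0, b)) * h" for h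
          using linear_scale[OF lin, of h "(0, d)"]
          by (simp add: linear_snd_expand[OF lin, of d])
        ultimately show ?thesis by (simp add: has_field_derivative_def)
      qed
      let ?f1 = "\<lambda>r. \<Sum>b\<in>Basis. inner d b * J b (?x r)"
      let ?f2 = "\<lambda>r. \<Sum>b\<in>Basis. inner d b * (\<Sum>c\<in>Basis. inner d c * J' b (?x r) (0, c))"
      have f1: "((\<lambda>r. F (?x r)) has_real_derivative ?f1 r) (at r)" for r
        using dir[OF F'(1)] by (simp add: J_def)
      have f2: "(?f1 has_real_derivative ?f2 r) (at r)" for r
        by (intro DERIV_sum DERIV_cmult dir J')
      \<comment> \<open>Two mean value steps along the segment, the second one on the derivative
        between 0 and \<open>z\<close>, leave the remainder \<open>z * ?f2 y\<close>, which is
        quadratic in \<open>d\<close>.\<close>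
      obtain z where z: "0 < z" "z < 1" "F (?x 1) - F (?x 0) = (1 - 0) * ?f1 z"
        using MVT2[of 0 1 "\<lambda>r. F (?x r)" ?f1] f1 by auto
      obtain y where y: "0 < y" "y < z" "?f1 z - ?f1 0 = (z - 0) * ?f2 y"
        using MVT2[of 0 z ?f1 ?f2] f2 z by auto
      have inn: "\<bar>inner d b\<bar> \<le> norm d" if "b \<in> Basis" for b
        using that by (rule Basis_le_norm)
      have "\<bar>?f2 y\<bar> \<le> (\<Sum>b\<in>Basis. norm d * (\<Sum>c\<in>Basis. norm d * C b c))"
      proof (intro order.trans[OF sum_abs] sum_mono)
        fix b :: 'v assume b: "b \<in> Basis"
        have "\<bar>\<Sum>c\<in>Basis. inner d c * J' b (?x y) (0, c)\<bar> \<le> (\<Sum>c\<in>Basis. norm d * C b c)"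
          using y z by (intro order.trans[OF sum_abs] sum_mono)
            (auto simp: abs_mult intro!: mult_mono inn C xK)
        then show "\<bar>inner d b * (\<Sum>c\<in>Basis. inner d c * J' b (?x y) (0, c))\<bar> \<le>
            norm d * (\<Sum>c\<in>Basis. norm d * C b c)"
          unfolding abs_mult using b by (intro mult_mono inn) auto
      qed
      also have "\<dots> = (\<Sum>b\<in>Basis. \<Sum>c\<in>Basis. C b c) * (norm d)\<^sup>2"
        by (simp add: sum_distrib_left sum_distrib_right power2_eq_square mult_ac)
      finally have "\<bar>?f2 y\<bar> \<le> (\<Sum>b\<in>Basis. \<Sum>c\<in>Basis. C b c) * (norm d)\<^sup>2" .
      moreover have "\<bar>z * ?f2 y\<bar> \<le> \<bar>?f2 y\<bar>"
        using z by (simp add: abs_mult mult_left_le_one_le)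
      moreover have "F (t, v + d) - F (t, v) - (\<Sum>b\<in>Basis. inner d b * J b (t, v)) = z * ?f2 y"
        using y(3) z(3) by simp
      ultimately show "\<bar>F (t, v + d) - F (t, v) - (\<Sum>b\<in>Basis. inner d b * J b (t, v))\<bar> \<le>
          (\<Sum>b\<in>Basis. \<Sum>c\<in>Basis. C b c) * (norm d)\<^sup>2"
        by linarith
    qed
  qed
qed

text \<open>The coefficients of \<open>p\<close> are chosen one degree at a time to cancel the lowest term of the residual.\<close>

lemma approximate_adjoint:
  fixes J :: "'i \<Rightarrow> 'i \<Rightarrow> real poly" and a :: "'i \<Rightarrow> real"
  shows "\<exists>p. \<forall>i. Polynomial.degree (p i) \<le> n \<and> poly (p i) 0 = a i \<and>
    [:0, 1:] ^ n dvd pderiv (p i) + (\<Sum>j\<in>I. J j i * p j)"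
proof (induction n)
  case 0
  show ?case by (intro exI[of _ "\<lambda>i. [:a i:]"]) simp
next
  case (Suc n)
  then obtain p where p: "\<And>i. Polynomial.degree (p i) \<le> n" "\<And>i. poly (p i) 0 = a i"
    "\<And>i. [:0, 1:] ^ n dvd pderiv (p i) + (\<Sum>j\<in>I. J j i * p j)"
    by blast
  then obtain q where q: "\<And>i. pderiv (p i) + (\<Sum>j\<in>I. J j i * p j) = [:0, 1:] ^ n * q i"
    unfolding dvd_def by metis
  \<comment> \<open>Differentiating the term of degree \<open>Suc n\<close> produces the factor
    \<open>Suc n\<close>, hence the denominator. The change of the sum with \<open>J\<close> is
    divisible by the next power and does not disturb the cancellation.\<close>
  define c where "c i = poly (q i) 0 / real (Suc n)" for i
  define p' where "p' i = p i - Polynomial.smult (c i) ([:0, 1:] ^ Suc n)" for i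
  show ?case
  proof (intro exI allI conjI)
    fix i
    have "Polynomial.degree (Polynomial.smult (c i) ([:0, 1:] ^ Suc n :: real poly)) \<le> Suc n"
      by (rule order.trans[OF degree_smult_le]) (simp add: degree_power_eq del: power_Suc)
    then show "Polynomial.degree (p' i) \<le> Suc n"
      unfolding p'_def using p(1)[of i] by (intro degree_diff_le) auto
    show "poly (p' i) 0 = a i" by (simp add: p'_def p)
    have "[:0, 1:] dvd q i - [:poly (q i) 0:]"
      using poly_eq_0_iff_dvd[of "q i - [:poly (q i) 0:]" 0] by simp
    then have "[:0, 1:] ^ n * [:0, 1:] dvd [:0, 1:] ^ n * (q i - [:poly (q i) 0:])"
      by (rule mult_dvd_mono[OF dvd_refl])
    then have 1: "[:0, 1:] ^ Suc n dvd [:0, 1:] ^ n * (q i - [:poly (q i) 0:])"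
      by (simp only: power_Suc2)
    have 2: "[:0, 1:] ^ Suc n dvd (\<Sum>j\<in>I. J j i * Polynomial.smult (c j) ([:0, 1:] ^ Suc n))"
      by (intro dvd_sum dvd_mult dvd_smult dvd_refl)
    have "pderiv (p' i) = pderiv (p i) - Polynomial.smult (c i * real (Suc n)) ([:0, 1:] ^ n)"
      by (simp only: p'_def pderiv_diff pderiv_smult pderiv_power_Suc) (simp add: pderiv_pCons)
    also have "c i * real (Suc n) = poly (q i) 0"
      by (simp add: c_def del: of_nat_Suc)
    also have "Polynomial.smult (poly (q i) 0) ([:0, 1:] ^ n) = [:0, 1:] ^ n * [:poly (q i) 0:]"
      by simp
    finally have "pderiv (p' i) = pderiv (p i) - [:0, 1:] ^ n * [:poly (q i) 0:]" .
    moreover have "(\<Sum>j\<in>I. J j i * p' j) = (\<Sum>j\<in>I. J j i * p j)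
        - (\<Sum>j\<in>I. J j i * Polynomial.smult (c j) ([:0, 1:] ^ Suc n))"
      unfolding p'_def right_diff_distrib sum_subtractf ..
    ultimately have "pderiv (p' i) + (\<Sum>j\<in>I. J j i * p' j) =
        [:0, 1:] ^ n * (q i - [:poly (q i) 0:])
        - (\<Sum>j\<in>I. J j i * Polynomial.smult (c j) ([:0, 1:] ^ Suc n))"
      unfolding right_diff_distrib[of "[:0, 1:] ^ n"] q[of i, symmetric] by (simp only: add_diff_eq diff_add_eq diff_diff_eq2 diff_diff_add add_ac)
    then show "[:0, 1:] ^ Suc n dvd pderiv (p' i) + (\<Sum>j\<in>I. J j i * p' j)"
      using dvd_diff[OF 1 2] by (simp only:)
  qed
qed

section \<open>Stages and stage errors\<close>

text \<open>The stage equations are a fixed point problem which, in the supremum distance over the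
  stages, is a contraction with factor \<open>h * K * L\<close> for small \<open>h\<close>; Banach's
  theorem solves it.\<close>

lemma rk_step_exists:
  fixes G :: "real \<Rightarrow> real ^ 'q::finite \<Rightarrow> real ^ 'q"
  assumes lip: "\<And>t. L-lipschitz_on UNIV (G t)"
  shows "\<forall>\<^sub>F h in at_right 0. \<exists>U. rk_step S A b c G t h un U"
proof -
  \<comment> \<open>The sum of all absolute entries is a crude bound for every row sum of
    \<open>A\<close>.\<close>
  define K where "K = (\<Sum>s<S. \<Sum>r<S. \<bar>A $$ (s, r)\<bar>)"
  have L0: "0 \<le> L" using lip lipschitz_on_nonneg by blast
  have K0: "0 \<le> K" unfolding K_def by (intro sum_nonneg) auto
  have "((\<lambda>h. h * K * L) \<longlongrightarrow> 0 * K * L) (at_right 0)"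
    by (intro tendsto_intros)
  then have "\<forall>\<^sub>F h in at_right 0. h * K * L < 1"
    by (rule order_tendstoD) simp
  moreover have "\<forall>\<^sub>F h in at_right 0. h \<in> {0<..<1 :: real}"
    by (rule eventually_at_right_real) simp
  ultimately show ?thesis
  proof eventually_elim
    case (elim h)
    \<comment> \<open>Stage vectors live in the complete space of bounded functions on a discrete copy of \<open>nat\<close>.\<close>
    define F where "F = (\<lambda>(y :: nat \<Rightarrow> real ^ 'q) s. if s < S
      then un + h *\<^sub>R (\<Sum>r<S. (A $$ (s, r)) *\<^sub>R G (t + c r * h) (y r)) else 0)"
    \<comment> \<open>Components from \<open>S\<close> on are set to 0, so the range is finite and
      therefore bounded; continuity is automatic on a discrete space.\<close>
    have F: "F y \<circ> of_discrete \<in> bcontfun" for y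
    proof -
      have "range (F y \<circ> of_discrete) \<subseteq> F y ` {..<S} \<union> {0}"
        by (auto simp: F_def)
      then have "finite (range (F y \<circ> of_discrete))"
        by (rule finite_subset) simp
      moreover have "continuous_on UNIV (F y \<circ> of_discrete)"
        by (simp add: continuous_on_open_vimage open_discrete)
      ultimately show ?thesis
        by (auto simp: bcontfun_def finite_imp_bounded)
    qed
    define stages where "stages y r = apply_bcontfun y (discrete r)" for y :: "nat discrete \<Rightarrow>\<^sub>C (real ^ 'q)" and r
    define T where "T y = Bcontfun (F (stages y) \<circ> of_discrete)" for y
    have T: "apply_bcontfun (T y) s = F (stages y) (of_discrete s)" for y s
      unfolding T_def using F by (simp add: Bcontfun_inverse)
    have "\<exists>!y. T y = y"
    proof (rule banach_fix_type)
      show "0 \<le> h * K * L" using elim K0 L0 by simp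
      show "h * K * L < 1" using elim by simp
      show "\<forall>x y. dist (T x) (T y) \<le> h * K * L * dist x y"
      proof (intro allI dist_bound)
        fix x y s
        let ?x = "stages x" and ?y = "stages y"
        show "dist (apply_bcontfun (T x) s) (apply_bcontfun (T y) s) \<le> h * K * L * dist x y"
        proof (cases "of_discrete s < S")
          case True
          let ?s = "of_discrete s"
          have "norm (\<Sum>r<S. (A $$ (?s, r)) *\<^sub>R (G (t + c r * h) (?x r) - G (t + c r * h) (?y r)))
              \<le> (\<Sum>r<S. \<bar>A $$ (?s, r)\<bar> * (L * dist x y))"
          proof (intro order.trans[OF norm_sum] sum_mono)
            fix r
            have "norm (G (t + c r * h) (?x r) - G (t + c r * h) (?y r)) \<le> L * dist (?x r) (?y r)"
              using lipschitz_onD[OF lip] by (simp add: dist_norm)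
            also have "\<dots> \<le> L * dist x y"
              using L0 by (auto simp: stages_def intro!: mult_left_mono dist_bounded)
            finally show "norm ((A $$ (?s, r)) *\<^sub>R (G (t + c r * h) (?x r) - G (t + c r * h) (?y r)))
                \<le> \<bar>A $$ (?s, r)\<bar> * (L * dist x y)"
              by (simp add: mult_left_mono)
          qed
          also have "\<dots> = (\<Sum>r<S. \<bar>A $$ (?s, r)\<bar>) * (L * dist x y)"
            by (simp add: sum_distrib_right)
          also have "\<dots> \<le> K * (L * dist x y)"
          proof (rule mult_right_mono)
            show "(\<Sum>r<S. \<bar>A $$ (?s, r)\<bar>) \<le> K"
              unfolding K_def using True by (intro member_le_sum) (auto intro: sum_nonneg)
          qed (use L0 in simp)
          finally have *: "norm (\<Sum>r<S. (A $$ (?s, r)) *\<^sub>R (G (t + c r * h) (?x r) - G (t + c r * h) (?y r)))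
              \<le> K * (L * dist x y)" .
          have "F ?x ?s - F ?y ?s =
              h *\<^sub>R (\<Sum>r<S. (A $$ (?s, r)) *\<^sub>R (G (t + c r * h) (?x r) - G (t + c r * h) (?y r)))"
            using True by (simp add: F_def scaleR_diff_right sum_subtractf)
          then have "dist (F ?x ?s) (F ?y ?s) =
              h * norm (\<Sum>r<S. (A $$ (?s, r)) *\<^sub>R (G (t + c r * h) (?x r) - G (t + c r * h) (?y r)))"
            using elim by (simp add: dist_norm)
          also have "\<dots> \<le> h * (K * (L * dist x y))"
            using elim by (intro mult_left_mono *) auto
          finally show ?thesis by (simp add: T mult.assoc)
        qed (use elim K0 L0 in \<open>simp add: T F_def\<close>)
      qed
    qed
    then obtain y where "T y = y" by blast
    then have "stages y s = F (stages y) s" for s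
      using T[of y "discrete s"] unfolding stages_def by (simp add: discrete_inverse)
    then have "stages y s = un + h *\<^sub>R (\<Sum>r<S. (A $$ (s, r)) *\<^sub>R G (t + c r * h) (stages y r))"
      if "s < S" for s
      by (rule trans) (simp add: F_def that)
    then show ?case unfolding rk_step_def by blast
  qed
qed

section \<open>Auxiliary order estimates and rescaling\<close>

lemma bigo_rescale:
  fixes f :: "real \<Rightarrow> real"
  assumes f: "f \<in> O[at_right 0](\<lambda>s. s ^ n)" and x: "0 < x"
  shows "(\<lambda>h. f (x * h)) \<in> O[at_right 0](\<lambda>h. h ^ n)"
proof -
  obtain c where c: "c > 0" "\<forall>\<^sub>F s in at_right 0. norm (f s) \<le> c * norm (s ^ n)"
    using landau_o.bigE[OF f] by blast
  then obtain b where b: "b > 0" "\<And>s. 0 < s \<Longrightarrow> s < b \<Longrightarrow> \<bar>f s\<bar> \<le> c * s ^ n"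
    unfolding eventually_at_right_field by auto
  have "\<forall>\<^sub>F h in at_right 0. h \<in> {0<..<b / x}"
    using b x by (intro eventually_at_right_real) auto
  then have "\<forall>\<^sub>F h in at_right 0. norm (f (x * h)) \<le> (c * x ^ n) * norm (h ^ n)"
  proof eventually_elim
    case (elim h)
    then show ?case
      using b(2)[of "x * h"] x by (simp add: field_simps power_mult_distrib)
  qed
  then show ?thesis by (rule bigoI)
qed

lemma bigo_power_tendsto_0:
  fixes f :: "real \<Rightarrow> real"
  assumes "f \<in> O[at_right 0](\<lambda>s. s ^ Suc n)"
  shows "(f \<longlongrightarrow> 0) (at_right 0)"
proof -
  obtain c where c: "\<forall>\<^sub>F s in at_right 0. norm (f s) \<le> c * norm (s ^ Suc n)"
    using landau_o.bigE[OF assms] by blast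
  have "((\<lambda>s::real. c * norm (s ^ Suc n)) \<longlongrightarrow> c * norm ((0::real) ^ Suc n)) (at_right 0)"
    by (intro tendsto_intros)
  then have "((\<lambda>s::real. c * norm (s ^ Suc n)) \<longlongrightarrow> 0) (at_right 0)" by simp
  with c show ?thesis by (rule Lim_null_comparison)
qed

text \<open>Once \<open>Z\<close> is below 1/2, half of \<open>E\<close> can be moved to the left,
  so \<open>E\<close> is at most twice \<open>D\<close>. This closes the self-referential estimates
  for the stage errors and for the final error.\<close>

lemma bigo_absorb:
  fixes E Z D :: "real \<Rightarrow> real"
  assumes E: "\<forall>\<^sub>F h in F. E h \<le> Z h * E h + D h" "\<And>h. 0 \<le> E h"
    and Z: "(Z \<longlongrightarrow> 0) F" and D: "D \<in> O[F](g)"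
  shows "E \<in> O[F](g)"
proof -
  have "\<forall>\<^sub>F h in F. Z h < 1 / 2"
    using Z by (rule order_tendstoD) simp
  with E(1) have "\<forall>\<^sub>F h in F. norm (E h) \<le> 2 * norm (D h)"
  proof eventually_elim
    case (elim h)
    have "Z h * E h \<le> 1 / 2 * E h"
      using elim E(2) by (intro mult_right_mono) auto
    with elim E(2)[of h] show ?case by simp
  qed
  then have "E \<in> O[F](D)" by (rule bigoI)
  then show ?thesis using D by (rule landau_o.big_trans)
qed

lemma bigo_times_h:
  assumes "f \<in> O[at_right (0::real)](\<lambda>h. h ^ n)"
  shows "(\<lambda>h. h * f h :: real) \<in> O[at_right 0](\<lambda>h. h ^ Suc n)"
  using landau_o.big.mult[OF landau_o.big_refl[of "\<lambda>h. h"] assms] by simp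

lemma solution_component_derivative:
  assumes "ode_solution G u"
  shows "((\<lambda>s. inner (u (t + s)) b) has_real_derivative inner (G (t + s) (u (t + s))) b) (at s)"
proof -
  have "(u has_vector_derivative G (s + t) (u (s + t))) (at (s + t))"
    using assms by (simp add: ode_solution_def)
  then have "((\<lambda>s. inner (u s) b) has_real_derivative inner (G (s + t) (u (s + t))) b) (at (s + t))"
    unfolding has_real_derivative_iff_has_vector_derivative
    by (rule bounded_linear.has_vector_derivative[OF bounded_linear_inner_left])
  from DERIV_shift[THEN iffD1, OF this] show ?thesis
    by (simp add: add.commute)
qed

lemma degree_pcompose_scale: "Polynomial.degree p \<le> n \<Longrightarrow> Polynomial.degree (pcompose p [:0, h :: real:]) \<le> n"
  by (rule order.trans[OF degree_pcompose_le]) (auto intro: order.trans[rotated])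

lemma pderiv_pcompose_scale:
  "pderiv (pcompose p [:0, h :: real:]) = Polynomial.smult h (pcompose (pderiv p) [:0, h:])"
  by (simp add: pderiv_pcompose pderiv_pCons mult.commute)

section \<open>Quadrature error and stage errors\<close>

context glg
begin

text \<open>Replace \<open>f'\<close> by its truncated expansion \<open>p\<close>. Rescaling [0, h]
  to the unit interval makes the quadrature exact for \<open>p\<close>, and both remainders gain a
  factor \<open>h\<close>, one by integration and one from the explicit factor.\<close>

lemma quadrature_error:
  assumes f: "\<And>s. (f has_real_derivative f' s) (at s)" and f': "poly_expansion (2 * M + 1) f'"
  shows "(\<lambda>h. f h - f 0 - h * (\<Sum>q\<le>M. w q * f' (xi q * h))) \<in> O[at_right 0](\<lambda>h. h ^ (2 * M + 2))"
proof -
  obtain p where dp: "Polynomial.degree p \<le> 2 * M"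
    and p: "(\<lambda>s. f' s - poly p s) \<in> O[at_right 0](\<lambda>s. s ^ Suc (2 * M))"
    using poly_expansion_truncate[of "2 * M" f'] f' by auto
  obtain P where P: "pderiv P = p" "poly P 0 = 0"
    by (rule poly_antiderivative)
  have "poly P h = h * (\<Sum>q\<le>M. w q * poly p (xi q * h))" for h
  proof -
    have "poly P h = I01 (pderiv (pcompose P [:0, h:]))"
      by (simp add: I01_pderiv poly_pcompose P)
    also have "\<dots> = h * Q (pcompose p [:0, h:])"
      using degree_pcompose_scale[OF dp, of h]
      by (simp add: pderiv_pcompose_scale P I01_smult Q_exact)
    finally show ?thesis by (simp add: Q_def poly_pcompose)
  qed
  then have "(\<lambda>h. f h - f 0 - h * (\<Sum>q\<le>M. w q * f' (xi q * h))) =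
      (\<lambda>h. (f h - f 0 - poly P h) - h * (\<Sum>q\<le>M. w q * (f' (xi q * h) - poly p (xi q * h))))"
    by (auto simp: algebra_simps sum_subtractf)
  also have "\<dots> \<in> O[at_right 0](\<lambda>h. h ^ Suc (Suc (2 * M)))"
  proof (rule sum_in_bigo(2)[OF _ bigo_times_h])
    show "(\<lambda>h. f h - f 0 - poly P h) \<in> O[at_right 0](\<lambda>h. h ^ Suc (Suc (2 * M)))"
      by (rule bigo_antiderivative[OF _ _ p]) (auto intro!: derivative_eq_intros f simp: P)
    show "(\<lambda>h. \<Sum>q\<le>M. w q * (f' (xi q * h) - poly p (xi q * h))) \<in> O[at_right 0](\<lambda>h. h ^ Suc (2 * M))"
      using bigo_rescale[OF p xi_pos] by (intro big_sum_in_bigo) auto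
  qed
  finally show ?thesis by simp
qed

text \<open>The argument of \<open>quadrature_error\<close> with \<open>stage_order\<close> in the
  place of exact quadrature, for the integral up to an inner node.\<close>

lemma stage_defect:
  assumes f: "\<And>s. (f has_real_derivative f' s) (at s)" and f': "poly_expansion M f'"
    and M: "M \<ge> 1" and s: "s \<le> M"
  shows "(\<lambda>h. f (xi s * h) - f 0 - h * (\<Sum>r\<le>M. A $$ (s, r) * f' (xi r * h))) \<in> O[at_right 0](\<lambda>h. h ^ (M + 1))"
proof -
  \<comment> \<open>Truncation at degree \<open>M - 1\<close> gives an antiderivative of degree at
    most \<open>M\<close>, the range of \<open>stage_order\<close>.\<close>
  obtain m where m: "M = Suc m" using M by (cases M) auto
  obtain p where dp: "Polynomial.degree p \<le> m"
    and p: "(\<lambda>s. f' s - poly p s) \<in> O[at_right 0](\<lambda>s. s ^ M)"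
    using poly_expansion_truncate[of m f'] f' unfolding m by blast
  obtain P where P: "pderiv P = p" "poly P 0 = 0"
    by (rule poly_antiderivative)
  have dP: "Polynomial.degree P \<le> M"
    using dp P(1) m degree_pderiv[of P] by simp
  have "poly P (xi s * h) = h * (\<Sum>r\<le>M. A $$ (s, r) * poly p (xi r * h))" for h
    using stage_order[OF degree_pcompose_scale[OF dP, of h] s]
    by (simp add: pderiv_pcompose_scale P poly_pcompose sum_distrib_left mult_ac)
  then have "(\<lambda>h. f (xi s * h) - f 0 - h * (\<Sum>r\<le>M. A $$ (s, r) * f' (xi r * h))) =
      (\<lambda>h. (f (xi s * h) - f 0 - poly P (xi s * h)) -
        h * (\<Sum>r\<le>M. A $$ (s, r) * (f' (xi r * h) - poly p (xi r * h))))"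
    by (auto simp: algebra_simps sum_subtractf)
  also have "\<dots> \<in> O[at_right 0](\<lambda>h. h ^ Suc M)"
  proof (rule sum_in_bigo(2)[OF _ bigo_times_h])
    have "(\<lambda>h. f h - f 0 - poly P h) \<in> O[at_right 0](\<lambda>h. h ^ Suc M)"
      by (rule bigo_antiderivative[OF _ _ p]) (auto intro!: derivative_eq_intros f simp: P)
    from bigo_rescale[OF this xi_pos[OF s]]
    show "(\<lambda>h. f (xi s * h) - f 0 - poly P (xi s * h)) \<in> O[at_right 0](\<lambda>h. h ^ Suc M)" .
    show "(\<lambda>h. \<Sum>r\<le>M. A $$ (s, r) * (f' (xi r * h) - poly p (xi r * h))) \<in> O[at_right 0](\<lambda>h. h ^ M)"
      using bigo_rescale[OF p xi_pos] by (intro big_sum_in_bigo) auto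
  qed
  finally show ?thesis by simp
qed

lemma expansion_rhs:
  fixes u :: "real \<Rightarrow> real ^ 'q::finite"
  assumes "Ck n (\<lambda>(t, v). G t v)" "ode_solution G u"
  shows "poly_expansion n (\<lambda>s. inner (G (t + s) (u (t + s))) b)"
  using poly_expansion_along_solution[OF assms(1)
      Ck_compose_bounded_linear[OF bounded_linear_inner_left assms(1)] assms(2)]
  by simp

text \<open>Subtracting the stage equations from those of the exact solution, up to their defect
  \<open>d\<close>, and using the Lipschitz bound estimates the total stage error \<open>E\<close>
  by \<open>h * K * L\<close> times itself plus the defects; \<open>bigo_absorb\<close>
  finishes.\<close>

lemma stage_error:
  fixes u :: "real \<Rightarrow> real ^ 'q::finite"
  assumes lip: "\<And>t. L-lipschitz_on UNIV (G t)" and G: "Ck M (\<lambda>(t, v). G t v)"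
    and u: "ode_solution G u" and M: "M \<ge> 1"
    and y: "\<forall>\<^sub>F h in at_right 0. \<forall>s\<le>M. y h s = u t + h *\<^sub>R (\<Sum>r\<le>M. (A $$ (s, r)) *\<^sub>R G (t + xi r * h) (y h r))"
    and q: "q \<le> M"
  shows "(\<lambda>h. norm (y h q - u (t + xi q * h))) \<in> O[at_right 0](\<lambda>h. h ^ (M + 1))"
proof -
  define e where "e h s = y h s - u (t + xi s * h)" for h s
  define E where "E h = (\<Sum>s\<le>M. norm (e h s))" for h
  define d where "d h s = u (t + xi s * h) - u t
    - h *\<^sub>R (\<Sum>r\<le>M. (A $$ (s, r)) *\<^sub>R G (t + xi r * h) (u (t + xi r * h)))" for h s
  define K where "K = (\<Sum>s\<le>M. \<Sum>r\<le>M. \<bar>A $$ (s, r)\<bar>)"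
  have L0: "0 \<le> L" using lip lipschitz_on_nonneg by blast
  have e_le: "norm (e h r) \<le> E h" if "r \<le> M" for h r
    unfolding E_def using that by (intro member_le_sum) auto
  have d: "(\<lambda>h. \<Sum>b\<in>Basis. \<bar>inner (d h s) b\<bar>) \<in> O[at_right 0](\<lambda>h. h ^ (M + 1))" if "s \<le> M" for s
  proof (rule big_sum_in_bigo)
    fix b :: "real ^ 'q"
    show "(\<lambda>h. \<bar>inner (d h s) b\<bar>) \<in> O[at_right 0](\<lambda>h. h ^ (M + 1))"
      using stage_defect[OF solution_component_derivative[OF u, of t b] expansion_rhs[OF G u] M that]
      by (simp add: d_def inner_diff_left inner_sum_left)
  qed
  have "\<forall>\<^sub>F h in at_right 0. h \<in> {0<..<1 :: real}"
    by (rule eventually_at_right_real) simp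
  with y have absorb: "\<forall>\<^sub>F h in at_right 0. E h \<le> (h * K * L) * E h + (\<Sum>s\<le>M. \<Sum>b\<in>Basis. \<bar>inner (d h s) b\<bar>)"
  proof eventually_elim
    case (elim h)
    have e_bound: "norm (e h s) \<le> h * (\<Sum>r\<le>M. \<bar>A $$ (s, r)\<bar>) * (L * E h) + (\<Sum>b\<in>Basis. \<bar>inner (d h s) b\<bar>)"
      if s: "s \<le> M" for s
    proof -
      let ?D = "\<lambda>r. G (t + xi r * h) (y h r) - G (t + xi r * h) (u (t + xi r * h))"
      have ab: "p - q = X - Y - (q - r - Y)" if "p = r + X" for p q r X Y :: "real ^ 'q"
        using that by simp
      have "y h s = u t + h *\<^sub>R (\<Sum>r\<le>M. (A $$ (s, r)) *\<^sub>R G (t + xi r * h) (y h r))"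
        using elim(1) s by blast
      then have "e h s = h *\<^sub>R (\<Sum>r\<le>M. (A $$ (s, r)) *\<^sub>R ?D r) - d h s"
        unfolding e_def d_def scaleR_diff_right sum_subtractf by (rule ab)
      then have "norm (e h s) \<le> norm (h *\<^sub>R (\<Sum>r\<le>M. (A $$ (s, r)) *\<^sub>R ?D r)) + norm (d h s)"
        by (simp only: norm_triangle_ineq4)
      also have "norm (h *\<^sub>R (\<Sum>r\<le>M. (A $$ (s, r)) *\<^sub>R ?D r)) \<le> h * (\<Sum>r\<le>M. \<bar>A $$ (s, r)\<bar> * (L * E h))"
      proof -
        have "norm (\<Sum>r\<le>M. (A $$ (s, r)) *\<^sub>R ?D r) \<le> (\<Sum>r\<le>M. \<bar>A $$ (s, r)\<bar> * (L * E h))"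
        proof (intro order.trans[OF norm_sum] sum_mono)
          fix r assume r: "r \<in> {..M}"
          have "norm (?D r) \<le> L * norm (e h r)"
            using lipschitz_onD[OF lip] by (simp add: dist_norm e_def)
          also have "\<dots> \<le> L * E h"
            using L0 r by (intro mult_left_mono e_le) auto
          finally show "norm ((A $$ (s, r)) *\<^sub>R ?D r) \<le> \<bar>A $$ (s, r)\<bar> * (L * E h)"
            by (simp add: mult_left_mono)
        qed
        then show ?thesis using elim(2) by simp
      qed
      also have "norm (d h s) \<le> (\<Sum>b\<in>Basis. \<bar>inner (d h s) b\<bar>)"
        by (rule norm_le_l1)
      finally show ?thesis
        unfolding sum_distrib_right[symmetric] mult.assoc by simp
    qed
    have "E h \<le> (\<Sum>s\<le>M. h * (\<Sum>r\<le>M. \<bar>A $$ (s, r)\<bar>) * (L * E h) + (\<Sum>b\<in>Basis. \<bar>inner (d h s) b\<bar>))"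
      unfolding E_def[of h] using e_bound[unfolded E_def[of h]] by (intro sum_mono) (simp only: atMost_iff)
    then show ?case
      unfolding sum.distrib sum_distrib_right[symmetric] sum_distrib_left[symmetric] K_def[symmetric]
      by (simp add: mult.assoc)
  qed
  have small: "((\<lambda>h. h * K * L) \<longlongrightarrow> 0) (at_right 0)"
    by (auto intro!: tendsto_eq_intros)
  have defect: "(\<lambda>h. \<Sum>s\<le>M. \<Sum>b\<in>Basis. \<bar>inner (d h s) b\<bar>) \<in> O[at_right 0](\<lambda>h. h ^ (M + 1))"
    by (rule big_sum_in_bigo) (rule d, simp)
  have E0: "0 \<le> E h" for h
    unfolding E_def by (rule sum_nonneg) simp
  have E: "E \<in> O[at_right 0](\<lambda>h. h ^ (M + 1))"
    by (rule bigo_absorb[OF absorb E0 small defect])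
  have "norm (norm (e h q)) \<le> 1 * norm (E h)" for h
    using e_le[OF q, of h] by simp
  then have "(\<lambda>h. norm (e h q)) \<in> O[at_right 0](E)"
    by (intro bigoI[of _ 1] always_eventually allI)
  from landau_o.big_trans[OF this E] show ?thesis
    unfolding e_def .
qed

end

section \<open>The error of one step\<close>

text \<open>Evaluates the Jacobian along the solution, so that it becomes a function of elapsed time
  alone with a polynomial expansion. The linearization error is quadratic in the distance from any
  \<open>y\<close> that converges to the solution.\<close>

lemma linearization_along_solution:
  fixes u :: "real \<Rightarrow> real ^ 'q::finite"
  assumes G: "Ck (Suc (Suc n)) (\<lambda>(t, v). G t v)" and u: "ode_solution G u"
  obtains J where "\<And>b c. poly_expansion (Suc n) (J b c)"
    "\<And>x y m b. 0 < x \<Longrightarrow> (\<lambda>h. norm (y h - u (t + x * h))) \<in> O[at_right 0](\<lambda>h. h ^ Suc m) \<Longrightarrow>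
      (\<lambda>h. inner (G (t + x * h) (y h)) b - inner (G (t + x * h) (u (t + x * h))) b -
        (\<Sum>c\<in>Basis. inner (y h - u (t + x * h)) c * J b c (x * h)))
      \<in> O[at_right 0](\<lambda>h. (norm (y h - u (t + x * h)))\<^sup>2)"
proof -
  define linearizes where "linearizes J b \<longleftrightarrow> (\<forall>K. compact K \<longrightarrow> convex K \<longrightarrow>
      (\<exists>C. \<forall>t v d. (t, v) \<in> K \<longrightarrow> (t, v + d) \<in> K \<longrightarrow>
       \<bar>inner (G t (v + d)) b - inner (G t v) b - (\<Sum>c\<in>Basis. inner d c * J c (t, v))\<bar> \<le> C * (norm d)\<^sup>2))"
    for J :: "real ^ 'q \<Rightarrow> real \<times> (real ^ 'q) \<Rightarrow> real" and b
  have "\<exists>J. (\<forall>c. Ck (Suc n) (J c)) \<and> linearizes J b" for b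
  proof (rule Ck_linearization[OF Ck_compose_bounded_linear[OF bounded_linear_inner_left G, of b], unfolded prod.case])
    fix J :: "real ^ 'q \<Rightarrow> real \<times> (real ^ 'q) \<Rightarrow> real"
    assume 1: "\<And>c. Ck (Suc n) (J c)" and
      2: "\<And>K. compact K \<Longrightarrow> convex K \<Longrightarrow> \<exists>C. \<forall>t v d. (t, v) \<in> K \<longrightarrow> (t, v + d) \<in> K \<longrightarrow>
       \<bar>inner (G t (v + d)) b - inner (G t v) b - (\<Sum>c\<in>Basis. inner d c * J c (t, v))\<bar> \<le> C * (norm d)\<^sup>2"
    show ?thesis
    proof (intro exI[of _ J] conjI)
      show "\<forall>c. Ck (Suc n) (J c)" using 1 by (rule allI)
      show "linearizes J b"
        unfolding linearizes_def by (intro allI impI, rule 2, assumption+)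
    qed
  qed
  then obtain J where J: "\<And>b c. Ck (Suc n) (J b c)" and lin: "\<And>b. linearizes (J b) b"
    by metis
  show thesis
  proof (rule that[of "\<lambda>b c s. J b c (t + s, u (t + s))"])
    show "poly_expansion (Suc n) (\<lambda>s. J b c (t + s, u (t + s)))" for b c
      by (rule poly_expansion_along_solution[OF Ck_SucD[OF G] J u])
  next
    fix x m b and y :: "real \<Rightarrow> real ^ 'q"
    assume x: "0 < x" and y: "(\<lambda>h. norm (y h - u (t + x * h))) \<in> O[at_right 0](\<lambda>h. h ^ Suc m)"
    have "compact (u ` {t..t + 1})"
      by (rule compact_continuous_image[OF continuous_on_subset[OF ode_solution_continuous[OF u] subset_UNIV] compact_Icc])
    then obtain R where "\<forall>s\<in>{t..t + 1}. norm (u s) \<le> R"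
      by (auto dest!: compact_imp_bounded simp: bounded_iff)
    then have R: "\<And>s. s \<in> {t..t + 1} \<Longrightarrow> norm (u s) \<le> R" by blast
    \<comment> \<open>\<open>R\<close> bounds the solution on [t, t + 1], and \<open>y\<close> is
      eventually within distance 1 of it, so a ball of radius \<open>R + 1\<close> contains
      both.\<close>
    define K where "K = {t..t + 1} \<times> cball (0 :: real ^ 'q) (R + 1)"
    have "compact K" "convex K"
      unfolding K_def by (rule compact_Times[OF compact_Icc compact_cball], rule convex_Times[OF convex_closed_interval convex_cball])
    then obtain C where C: "\<forall>s v d. (s, v) \<in> K \<longrightarrow> (s, v + d) \<in> K \<longrightarrow>
       \<bar>inner (G s (v + d)) b - inner (G s v) b - (\<Sum>c\<in>Basis. inner d c * J b c (s, v))\<bar> \<le> C * (norm d)\<^sup>2"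
      by (rule exE[OF lin[of b, unfolded linearizes_def, THEN spec, THEN mp, THEN mp]])
    have "\<forall>\<^sub>F h in at_right 0. norm (y h - u (t + x * h)) < 1"
      by (rule order_tendstoD(2)[OF bigo_power_tendsto_0[OF y]]) simp
    moreover have "\<forall>\<^sub>F h in at_right 0. h \<in> {0<..<1 / x}"
      using x by (intro eventually_at_right_real) auto
    ultimately have "\<forall>\<^sub>F h in at_right 0.
      norm (inner (G (t + x * h) (y h)) b - inner (G (t + x * h) (u (t + x * h))) b -
        (\<Sum>c\<in>Basis. inner (y h - u (t + x * h)) c * J b c (t + x * h, u (t + x * h))))
      \<le> C * norm ((norm (y h - u (t + x * h)))\<^sup>2)"
    proof eventually_elim
      case (elim h)
      let ?d = "y h - u (t + x * h)"
      have eq: "u (t + x * h) + ?d = y h" by simp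
      have "0 < x * h" "x * h < 1"
        using elim(2) x by (simp_all add: less_divide_eq mult.commute)
      then have xh: "t + x * h \<in> {t..t + 1}" by simp
      have "norm (u (t + x * h) + ?d) \<le> norm (u (t + x * h)) + norm ?d"
        by (rule norm_triangle_ineq)
      also have "\<dots> \<le> R + 1"
        using R[OF xh] elim(1) by (intro add_mono) auto
      finally have "(t + x * h, u (t + x * h) + ?d) \<in> K"
        unfolding K_def mem_Times_iff using xh by (simp only: fst_conv snd_conv mem_cball_0 simp_thms)
      moreover have "(t + x * h, u (t + x * h)) \<in> K"
        unfolding K_def using xh R[OF xh] by simp
      ultimately have "\<bar>inner (G (t + x * h) (u (t + x * h) + ?d)) b - inner (G (t + x * h) (u (t + x * h))) b -
          (\<Sum>c\<in>Basis. inner ?d c * J b c (t + x * h, u (t + x * h)))\<bar> \<le> C * (norm ?d)\<^sup>2"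
        by (intro C[rule_format])
      then show ?case
        by (simp only: eq real_norm_def abs_power2)
    qed
    then show "(\<lambda>h. inner (G (t + x * h) (y h)) b - inner (G (t + x * h) (u (t + x * h))) b -
        (\<Sum>c\<in>Basis. inner (y h - u (t + x * h)) c * J b c (t + x * h, u (t + x * h))))
      \<in> O[at_right 0](\<lambda>h. (norm (y h - u (t + x * h)))\<^sup>2)"
      by (rule bigoI)
  qed
qed

section \<open>The adjoint argument for a family of steps\<close>

text \<open>Stages and results are selected as functions of \<open>h\<close>, and their equations
  hold only for small \<open>h\<close>. Class \<open>2 * M + 2\<close> is what
  \<open>linearization_along_solution\<close> asks for to expand the Jacobian to order
  \<open>2 * M + 1\<close>.\<close>

locale glg_run = glg +
  fixes G :: "real \<Rightarrow> real ^ 'q::finite \<Rightarrow> real ^ 'q" and u t y U L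
  assumes M: "M \<ge> 1"
    and lip: "\<And>t. L-lipschitz_on UNIV (G t)"
    and G: "Ck (2 * M + 2) (\<lambda>(t, v). G t v)"
    and u: "ode_solution G u"
    and stages: "\<forall>\<^sub>F h in at_right 0. \<forall>s\<le>M.
      y h s = u t + h *\<^sub>R (\<Sum>r\<le>M. (A $$ (s, r)) *\<^sub>R G (t + xi r * h) (y h r))"
    and step: "\<forall>\<^sub>F h in at_right 0. U h = u t + h *\<^sub>R (\<Sum>r\<le>M. w r *\<^sub>R G (t + xi r * h) (y h r))"
begin

abbreviation "v q h \<equiv> u (t + xi q * h)"
abbreviation "eps q h \<equiv> y h q - v q h"

lemma G_mono: "n \<le> 2 * M + 2 \<Longrightarrow> Ck n (\<lambda>(t, v). G t v)"
  using Ck_mono G by blast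

lemma eps_bigo: "q \<le> M \<Longrightarrow> (\<lambda>h. norm (eps q h)) \<in> O[at_right 0](\<lambda>h. h ^ Suc M)"
  using stage_error[OF lip G_mono u M stages] by simp

text \<open>The weak form is tested with the rescaled polynomial x -> p(hx). The exact solution
  satisfies the same identity up to the quadrature error of the product of \<open>p\<close> and a
  component of \<open>u\<close>, so the difference of the two identities is exactly that
  error.\<close>

lemma component_error:
  assumes p: "Polynomial.degree p \<le> M"
  shows "(\<lambda>h. poly p h * inner (U h - u (t + h)) b - h * (\<Sum>q\<le>M. w q *
      (poly (pderiv p) (xi q * h) * inner (eps q h) b +
       poly p (xi q * h) * (inner (G (t + xi q * h) (y h q)) b - inner (G (t + xi q * h) (v q h)) b))))
    \<in> O[at_right 0](\<lambda>h. h ^ (2 * M + 2))" (is "?lhs \<in> _")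
proof -
  let ?f = "\<lambda>s. poly p s * inner (u (t + s)) b"
  let ?f' = "\<lambda>s. poly (pderiv p) s * inner (u (t + s)) b + poly p s * inner (G (t + s) (u (t + s))) b"
  let ?R = "\<lambda>h. ?f h - ?f 0 - h * (\<Sum>q\<le>M. w q * ?f' (xi q * h))"
  have f: "(?f has_real_derivative ?f' s) (at s)" for s
    using DERIV_mult[OF poly_DERIV[of p s] solution_component_derivative[OF u, of t b s]]
    by (simp add: mult.commute add.commute)
  \<comment> \<open>A component of \<open>u\<close> is the coordinate function of the state
    evaluated along the solution, so the general expansion lemma covers it.\<close>
  have "poly_expansion (2 * M + 1) (\<lambda>s. inner (snd (t + s, u (t + s))) b)"
    by (intro poly_expansion_along_solution[OF G_mono _ u] Ck_compose_bounded_linear[OF bounded_linear_inner_left]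
        Ck_bounded_linear bounded_linear_snd) simp
  then have "poly_expansion (2 * M + 1) ?f'"
    by (intro poly_expansion_add poly_expansion_mult poly_expansion_poly expansion_rhs[OF G_mono u]) simp_all
  from quadrature_error[OF f this] have R: "?R \<in> O[at_right 0](\<lambda>h. h ^ (2 * M + 2))" .
  have "\<forall>\<^sub>F h in at_right 0. ?lhs h = - ?R h"
    using stages step
  proof eventually_elim
    case (elim h)
    have ys: "inner (y h s) b = inner (u t) b + h * (\<Sum>r\<le>M. A $$ (s, r) * inner (G (t + xi r * h) (y h r)) b)"
      if "s \<le> M" for s
    proof -
      have "y h s = u t + h *\<^sub>R (\<Sum>r\<le>M. (A $$ (s, r)) *\<^sub>R G (t + xi r * h) (y h r))"
        using elim(1) that by blast
      from arg_cong[OF this, of "\<lambda>x. inner x b"] show ?thesis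
        by (simp only: inner_add_left inner_scaleR_left inner_sum_left)
    qed
    have Uh: "inner (U h) b = inner (u t) b + h * (\<Sum>r\<le>M. w r * inner (G (t + xi r * h) (y h r)) b)"
      using arg_cong[OF elim(2), of "\<lambda>x. inner x b"]
      by (simp only: inner_add_left inner_scaleR_left inner_sum_left)
    have "poly p h * inner (U h) b = poly p 0 * inner (u t) b +
        h * (\<Sum>q\<le>M. w q * (poly (pderiv p) (xi q * h) * inner (y h q) b +
          poly p (xi q * h) * inner (G (t + xi q * h) (y h q)) b))"
    proof -
      have "(\<Sum>q\<le>M. w q * (poly (pderiv (pcompose p [:0, h:])) (xi q) * inner (y h q) b +
            h * poly (pcompose p [:0, h:]) (xi q) * inner (G (t + xi q * h) (y h q)) b)) =
          h * (\<Sum>q\<le>M. w q * (poly (pderiv p) (xi q * h) * inner (y h q) b +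
            poly p (xi q * h) * inner (G (t + xi q * h) (y h q)) b))"
        unfolding sum_distrib_left
        by (intro sum.cong refl) (simp add: pderiv_pcompose_scale poly_pcompose algebra_simps)
      with weak_form[OF ys Uh degree_pcompose_scale[OF p, of h]] show ?thesis
        by (simp add: poly_pcompose)
    qed
    moreover have "poly p h * inner (U h - u (t + h)) b = poly p h * inner (U h) b - ?f h"
      by (simp add: inner_diff_left right_diff_distrib)
    moreover have "(\<Sum>q\<le>M. w q * (poly (pderiv p) (xi q * h) * inner (eps q h) b +
          poly p (xi q * h) * (inner (G (t + xi q * h) (y h q)) b - inner (G (t + xi q * h) (v q h)) b))) =
        (\<Sum>q\<le>M. w q * (poly (pderiv p) (xi q * h) * inner (y h q) b +
          poly p (xi q * h) * inner (G (t + xi q * h) (y h q)) b)) - (\<Sum>q\<le>M. w q * ?f' (xi q * h))"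
      unfolding sum_subtractf[symmetric]
      by (intro sum.cong refl) (simp add: inner_diff_left algebra_simps)
    ultimately show ?case
      by (simp only: right_diff_distrib) simp
  qed
  then have "?lhs \<in> O[at_right 0](\<lambda>h. h ^ (2 * M + 2)) \<longleftrightarrow> (\<lambda>h. - ?R h) \<in> O[at_right 0](\<lambda>h. h ^ (2 * M + 2))"
    by (rule landau_o.big.in_cong)
  then show ?thesis using R by (simp only: landau_o.big.uminus_in_iff)
qed

text \<open>Sum \<open>component_error\<close> over the components, with \<open>p\<close> an
  approximate adjoint solution starting at the unit vector \<open>a\<close>. In the unscaled
  variable the residual \<open>rho\<close> has order \<open>M\<close> and the stage errors order
  \<open>M + 1\<close>; with the factor \<open>h\<close> in front this makes
  \<open>2 * M + 2\<close>.\<close>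

lemma error_functional:
  obtains p where "\<And>b. poly (p b) 0 = (if b = a then 1 else 0)"
    "(\<lambda>h. \<Sum>b\<in>Basis. poly (p b) h * inner (U h - u (t + h)) b) \<in> O[at_right 0](\<lambda>h. h ^ (2 * M + 2))"
proof -
  obtain J where J: "\<And>b c. poly_expansion (Suc (2 * M)) (J b c)"
    and lin: "\<And>x y m b. 0 < x \<Longrightarrow> (\<lambda>h. norm (y h - u (t + x * h))) \<in> O[at_right 0](\<lambda>h. h ^ Suc m) \<Longrightarrow>
      (\<lambda>h. inner (G (t + x * h) (y h)) b - inner (G (t + x * h) (u (t + x * h))) b -
        (\<Sum>c\<in>Basis. inner (y h - u (t + x * h)) c * J b c (x * h)))
      \<in> O[at_right 0](\<lambda>h. (norm (y h - u (t + x * h)))\<^sup>2)"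
    using linearization_along_solution[of "2 * M" G u t] G u by auto
  \<comment> \<open>\<open>approximate_adjoint\<close> works with polynomial coefficients. Replacing
    \<open>J\<close> by \<open>Jp\<close> costs an error of order \<open>2 * M + 1\<close>, which
    does not spoil the order \<open>M\<close> of the residual.\<close>
  obtain Jp where Jp: "\<And>b c. (\<lambda>s. J b c s - poly (Jp b c) s) \<in> O[at_right 0](\<lambda>s. s ^ Suc (2 * M))"
    using J unfolding poly_expansion_def by metis
  obtain p where p: "\<And>b. Polynomial.degree (p b) \<le> M" "\<And>b. poly (p b) 0 = (if b = a then 1 else 0)"
    "\<And>b. [:0, 1:] ^ M dvd pderiv (p b) + (\<Sum>c\<in>Basis. Jp c b * p c)"
    using approximate_adjoint[of M "\<lambda>b. if b = a then 1 else 0" Jp Basis] by blast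
  define rho where "rho b s = poly (pderiv (p b)) s + (\<Sum>c\<in>Basis. J c b s * poly (p c) s)" for b s
  have rho: "rho b \<in> O[at_right 0](\<lambda>s. s ^ M)" for b
  proof -
    have "(\<lambda>s. (J c b s - poly (Jp c b) s) * poly (p c) s) \<in> O[at_right 0](\<lambda>s. s ^ M)" for c
      using landau_o.big.mult[OF landau_o.big_trans[OF Jp[of c b] power_bigo_power[of M]] poly_bigo_1[of "p c"]]
      by simp
    then have "(\<lambda>s. poly (pderiv (p b) + (\<Sum>c\<in>Basis. Jp c b * p c)) s +
        (\<Sum>c\<in>Basis. (J c b s - poly (Jp c b) s) * poly (p c) s)) \<in> O[at_right 0](\<lambda>s. s ^ M)"
      by (intro sum_in_bigo(1) power_dvd_bigo p big_sum_in_bigo)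
    also have "(\<lambda>s. poly (pderiv (p b) + (\<Sum>c\<in>Basis. Jp c b * p c)) s +
        (\<Sum>c\<in>Basis. (J c b s - poly (Jp c b) s) * poly (p c) s)) = rho b"
      by (auto simp: rho_def poly_sum algebra_simps sum_subtractf)
    finally show ?thesis .
  qed
  \<comment> \<open>The nonlinear remainder, quadratic in the stage errors and hence of order
    \<open>2 * M + 2\<close>.\<close>
  define N where "N q b h = inner (G (t + xi q * h) (y h q)) b - inner (G (t + xi q * h) (v q h)) b -
        (\<Sum>c\<in>Basis. inner (eps q h) c * J b c (xi q * h))" for q b h
  have N: "N q b \<in> O[at_right 0](\<lambda>h. h ^ Suc (2 * M))" if q: "q \<le> M" for q b
  proof -
    have "N q b \<in> O[at_right 0](\<lambda>h. (norm (eps q h))\<^sup>2)"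
      unfolding N_def by (rule lin[OF xi_pos[OF q] eps_bigo[OF q]])
    also have "(\<lambda>h. (norm (eps q h))\<^sup>2) \<in> O[at_right 0](\<lambda>h. (h ^ Suc M) ^ 2)"
      by (rule landau_o.big_power[OF eps_bigo[OF q]])
    also have "(\<lambda>h::real. (h ^ Suc M) ^ 2) = (\<lambda>h. h ^ (Suc M * 2))"
      by (simp only: power_mult)
    also have "(\<lambda>h::real. h ^ (Suc M * 2)) \<in> O[at_right 0](\<lambda>h. h ^ Suc (2 * M))"
      by (rule power_bigo_power) simp
    finally show ?thesis .
  qed
  have eps_rho: "(\<lambda>h. inner (eps q h) b * rho b (xi q * h)) \<in> O[at_right 0](\<lambda>h. h ^ Suc (2 * M))"
    if q: "q \<le> M" and b: "b \<in> Basis" for q b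
  proof -
    have "norm (inner (eps q h) b) \<le> 1 * norm (norm (eps q h))" for h
      using Basis_le_norm[OF b, of "eps q h"] by simp
    then have "(\<lambda>h. inner (eps q h) b) \<in> O[at_right 0](\<lambda>h. norm (eps q h))"
      by (intro bigoI[of _ 1] always_eventually allI)
    from landau_o.big.mult[OF landau_o.big_trans[OF this eps_bigo[OF q]] bigo_rescale[OF rho xi_pos[OF q]]]
    have "(\<lambda>h. inner (eps q h) b * rho b (xi q * h)) \<in> O[at_right 0](\<lambda>h. h ^ Suc M * h ^ M)" .
    then show ?thesis by (simp only: power_add[symmetric] add_Suc mult_2)
  qed
  define S where "S q h = (\<Sum>b\<in>Basis. inner (eps q h) b * rho b (xi q * h)) +
      (\<Sum>b\<in>Basis. poly (p b) (xi q * h) * N q b h)" for q h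
  have S: "S q \<in> O[at_right 0](\<lambda>h. h ^ Suc (2 * M))" if q: "q \<le> M" for q
  proof -
    have "(\<lambda>h. poly (p b) (xi q * h) * N q b h) \<in> O[at_right 0](\<lambda>h. h ^ Suc (2 * M))" for b
    proof -
      have "(\<lambda>h. poly (p b) (xi q * h)) \<in> O[at_right 0](\<lambda>h. h ^ 0)"
        by (rule bigo_rescale[OF _ xi_pos[OF q]]) (simp add: poly_bigo_1)
      from landau_o.big.mult[OF this N[OF q]] show ?thesis by simp
    qed
    then show ?thesis
      unfolding S_def by (intro sum_in_bigo(1) big_sum_in_bigo eps_rho[OF q])
  qed
  have S_eq: "S q h = (\<Sum>b\<in>Basis. poly (pderiv (p b)) (xi q * h) * inner (eps q h) b +
       poly (p b) (xi q * h) * (inner (G (t + xi q * h) (y h q)) b - inner (G (t + xi q * h) (v q h)) b))"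
    for q h
  proof -
    \<comment> \<open>Transposition: the Jacobian acting on the stage error, paired with
      \<open>p\<close>, equals the stage error paired with the transposed Jacobian acting on
      \<open>p\<close>. Hence the swapped indices in \<open>rho\<close>.\<close>
    have "(\<Sum>b\<in>Basis. \<Sum>c\<in>Basis. inner (eps q h) b * (J c b (xi q * h) * poly (p c) (xi q * h))) =
        (\<Sum>b\<in>Basis. \<Sum>c\<in>Basis. poly (p b) (xi q * h) * (inner (eps q h) c * J b c (xi q * h)))"
      by (subst sum.swap) (simp only: mult_ac)
    then show ?thesis
      unfolding S_def rho_def N_def
      by (simp only: distrib_left right_diff_distrib sum.distrib sum_subtractf sum_distrib_left)
        (simp add: mult.commute)
  qed
  let ?E = "\<lambda>b h. poly (p b) h * inner (U h - u (t + h)) b - h * (\<Sum>q\<le>M. w q *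
      (poly (pderiv (p b)) (xi q * h) * inner (eps q h) b +
       poly (p b) (xi q * h) * (inner (G (t + xi q * h) (y h q)) b - inner (G (t + xi q * h) (v q h)) b)))"
  have "(\<lambda>h. (\<Sum>b\<in>Basis. ?E b h) + h * (\<Sum>q\<le>M. w q * S q h)) \<in> O[at_right 0](\<lambda>h. h ^ Suc (Suc (2 * M)))"
  proof (rule sum_in_bigo(1)[OF _ bigo_times_h])
    show "(\<lambda>h. \<Sum>b\<in>Basis. ?E b h) \<in> O[at_right 0](\<lambda>h. h ^ Suc (Suc (2 * M)))"
      using component_error[OF p(1)] by (intro big_sum_in_bigo) simp
    have "(\<lambda>h. w q * S q h) \<in> O[at_right 0](\<lambda>h. h ^ Suc (2 * M))" if "q \<le> M" for q
      using S[OF that] by simp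
    then show "(\<lambda>h. \<Sum>q\<le>M. w q * S q h) \<in> O[at_right 0](\<lambda>h. h ^ Suc (2 * M))"
      by (intro big_sum_in_bigo) simp
  qed
  moreover have "(\<Sum>b\<in>Basis. ?E b h) + h * (\<Sum>q\<le>M. w q * S q h) =
      (\<Sum>b\<in>Basis. poly (p b) h * inner (U h - u (t + h)) b)" for h
    unfolding S_eq sum_subtractf sum_distrib_left
    by (subst sum.swap[of _ "{..M}" Basis]) simp
  ultimately have "(\<lambda>h. \<Sum>b\<in>Basis. poly (p b) h * inner (U h - u (t + h)) b) \<in> O[at_right 0](\<lambda>h. h ^ (2 * M + 2))"
    by simp
  with p(2) show thesis by (rule that)
qed

text \<open>The polynomials \<open>p a b\<close> form a matrix that is the identity at
  \<open>h = 0\<close>, so for small \<open>h\<close> the functionals \<open>X a\<close> control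
  every component of the error.\<close>

lemma step_error: "(\<lambda>h. norm (U h - u (t + h))) \<in> O[at_right 0](\<lambda>h. h ^ (2 * M + 2))"
proof -
  define functional where "functional a p \<longleftrightarrow> (\<forall>b. poly (p b) 0 = (if b = a then 1 else 0)) \<and>
    (\<lambda>h. \<Sum>b\<in>Basis. poly (p b) h * inner (U h - u (t + h)) b) \<in> O[at_right 0](\<lambda>h. h ^ (2 * M + 2))"
    for a p
  have "\<exists>p. functional a p" for a
    unfolding functional_def
    by (rule error_functional[of a]) (rule exI, rule conjI, rule allI)
  then obtain p where p: "\<And>a. functional a (p a)"
    by metis
  note p0 = p[unfolded functional_def, THEN conjunct1, rule_format]
  let ?e = "\<lambda>h. U h - u (t + h)"
  define X where "X a h = (\<Sum>b\<in>Basis. poly (p a b) h * inner (?e h) b)" for a h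
  \<comment> \<open>The deviation from the identity matrix; it tends to 0 with \<open>h\<close>,
    which makes its contribution absorbable.\<close>
  define d where "d a b h = poly (p a b) h - (if b = a then 1 else 0)" for a b h
  have bound: "norm (?e h) \<le> (\<Sum>a\<in>Basis. \<Sum>b\<in>Basis. \<bar>d a b h\<bar>) * norm (?e h) + (\<Sum>a\<in>Basis. \<bar>X a h\<bar>)" for h
  proof -
    have "\<bar>inner (?e h) a\<bar> \<le> (\<Sum>b\<in>Basis. \<bar>d a b h\<bar>) * norm (?e h) + \<bar>X a h\<bar>" if a: "a \<in> Basis" for a
    proof -
      have "X a h - (\<Sum>b\<in>Basis. d a b h * inner (?e h) b) =
          (\<Sum>b\<in>Basis. if b = a then inner (?e h) b else 0)"
        unfolding X_def d_def sum_subtractf[symmetric] by (intro sum.cong refl) (simp add: algebra_simps)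
      also have "\<dots> = inner (?e h) a" using a by simp
      finally have "\<bar>inner (?e h) a\<bar> \<le> \<bar>X a h\<bar> + \<bar>\<Sum>b\<in>Basis. d a b h * inner (?e h) b\<bar>"
        by linarith
      also have "\<bar>\<Sum>b\<in>Basis. d a b h * inner (?e h) b\<bar> \<le> (\<Sum>b\<in>Basis. \<bar>d a b h\<bar> * norm (?e h))"
        by (intro order.trans[OF sum_abs] sum_mono) (simp add: abs_mult Basis_le_norm mult_left_mono)
      finally show ?thesis by (simp add: sum_distrib_right)
    qed
    then have "(\<Sum>a\<in>Basis. \<bar>inner (?e h) a\<bar>) \<le>
        (\<Sum>a\<in>Basis. (\<Sum>b\<in>Basis. \<bar>d a b h\<bar>) * norm (?e h) + \<bar>X a h\<bar>)"
      by (rule sum_mono)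
    with norm_le_l1[of "?e h"] show ?thesis
      by (simp only: sum.distrib sum_distrib_right)
  qed
  have "((\<lambda>h. \<Sum>a\<in>Basis. \<Sum>b\<in>Basis. \<bar>d a b h\<bar>) \<longlongrightarrow> (\<Sum>a\<in>Basis. \<Sum>b\<in>Basis. \<bar>d a b 0\<bar>)) (at_right 0)"
    unfolding d_def by (intro tendsto_intros tendsto_poly)
  then have small: "((\<lambda>h. \<Sum>a\<in>Basis. \<Sum>b\<in>Basis. \<bar>d a b h\<bar>) \<longlongrightarrow> 0) (at_right 0)"
    by (simp add: d_def p0)
  have X: "(\<lambda>h. \<Sum>a\<in>Basis. \<bar>X a h\<bar>) \<in> O[at_right 0](\<lambda>h. h ^ (2 * M + 2))"
    by (rule big_sum_in_bigo)
      (simp only: X_def landau_o.big.abs_in_iff p[unfolded functional_def, THEN conjunct2])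
  show ?thesis
    by (rule bigo_absorb[OF always_eventually[OF allI[OF bound]] norm_ge_zero small X])
qed

end

theorem theorem3p9:
  fixes M S :: nat and xi :: "nat \<Rightarrow> real"
  assumes "M \<ge> 1" and "S = M + 1" and "glg_points M xi"
  shows "invertible_mat (ader_B M xi) \<and>
    rk_order TYPE('q::finite) S (ader_A M xi) (quad_weight M xi) xi (2 * S - 1)"
proof
  interpret glg M xi by unfold_locales fact
  show "invertible_mat (ader_B M xi)" by (rule B_invertible)
  show "rk_order TYPE('q) S (ader_A M xi) (quad_weight M xi) xi (2 * S - 1)"
    unfolding rk_order_def
  \<comment> \<open>The smoothness class is chosen from \<open>M\<close> alone, before
    \<open>G\<close> is introduced.\<close>
  proof (intro exI[of _ "2 * M + 2"] allI impI conjI)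
    fix G :: "real \<Rightarrow> real ^ 'q \<Rightarrow> real ^ 'q" and u t
    assume G: "admissible_rhs G" "Ck (2 * M + 2) (\<lambda>(t, v). G t v)" and u: "ode_solution G u"
    obtain L where L: "\<And>t. L-lipschitz_on UNIV (G t)"
      using G(1) unfolding admissible_rhs_def by blast
    show "\<forall>\<^sub>F h in at_right 0. \<exists>U. rk_step S (ader_A M xi) (quad_weight M xi) xi G t h (u t) U"
      by (rule rk_step_exists[OF L])
    fix U
    assume "\<forall>\<^sub>F h in at_right 0. rk_step S (ader_A M xi) (quad_weight M xi) xi G t h (u t) (U h)"
    then have ex: "\<forall>\<^sub>F h in at_right 0. \<exists>y.
        (\<forall>s\<le>M. y s = u t + h *\<^sub>R (\<Sum>r\<le>M. (A $$ (s, r)) *\<^sub>R G (t + xi r * h) (y r))) \<and>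
        U h = u t + h *\<^sub>R (\<Sum>r\<le>M. w r *\<^sub>R G (t + xi r * h) (y r))"
      by (simp only: rk_step_def assms(2) Suc_eq_plus1[symmetric] less_Suc_eq_le lessThan_Suc_atMost)
    \<comment> \<open>Choice turns the stages that exist for each small \<open>h\<close> into a
      function of \<open>h\<close>, as the error analysis expects.\<close>
    obtain y where y: "\<forall>\<^sub>F h in at_right 0.
        (\<forall>s\<le>M. y h s = u t + h *\<^sub>R (\<Sum>r\<le>M. (A $$ (s, r)) *\<^sub>R G (t + xi r * h) (y h r))) \<and>
        U h = u t + h *\<^sub>R (\<Sum>r\<le>M. w r *\<^sub>R G (t + xi r * h) (y h r))"
      by (rule exE[OF ex[unfolded eventually_ex]])
    interpret glg_run M xi G u t y U L
    proof
      show "\<forall>\<^sub>F h in at_right 0. \<forall>s\<le>M.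
          y h s = u t + h *\<^sub>R (\<Sum>r\<le>M. (A $$ (s, r)) *\<^sub>R G (t + xi r * h) (y h r))"
        using y by (rule eventually_mono) (rule conjunct1)
      show "\<forall>\<^sub>F h in at_right 0. U h = u t + h *\<^sub>R (\<Sum>r\<le>M. w r *\<^sub>R G (t + xi r * h) (y h r))"
        using y by (rule eventually_mono) (rule conjunct2)
    qed (fact assms(1) L G(2) u)+
    \<comment> \<open>With \<open>S = M + 1\<close> the exponent \<open>2 * S - 1 + 1\<close> is
      \<open>2 * M + 2\<close>.\<close>
    show "(\<lambda>h. norm (U h - u (t + h))) \<in> O[at_right 0](\<lambda>h. h ^ (2 * S - 1 + 1))"
      using step_error by (simp add: assms(2))
  qed
qed

end
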